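(* Let $\mathbb{D}$ be a unit-pure and fibrant double category that has tabulators. Then the category $D_0$ has pullbacks. If moreover the tabulators are strong, then $\mathbb{D}$ satisfies the Beck-Chevalley condition.
   Context: A (pseudo) double category $\mathbb D$ consists of: a category $D_0$ (objects and vertical arrows of $\mathbb D$); a category $D_1$ (its objects are called horizontal arrows, its arrows cells); functors $S,T:D_1\to D_0$, $U:D_0\to D_1$ and $\odot:D_1\times_{D_0}D_1\to D_1$ (defined on pairs $(M,N)$ with $SM=TN$) such that $SU=TU=\mathrm{id}$, $S(M\odot N)=SN$, $T(M\odot N)=TM$; and natural isomorphisms $(M\odot N)\odot P\cong M\odot(N\odot P)$, $U_{TM}\odot M\cong M$, $M\odot U_{SM}\cong M$ in $D_1$ whose components have identity source and target under $S,T$ and satisfy the pentagon and triangle axioms. Write $M:A\nrightarrow B$ if $SM=A$, $TM=B$. A cell $\alpha:M\to N$ with $S\alpha=f$, $T\alpha=g$ has sides $(f,g)$; it is globular if both sides are identities. $\mathbb D$ is unit-pure if the functor $U:D_0\to D_1$ is full. A cell $\alpha:M\to N$ with sides $(f,g)$ is Cartesian if every cell $M'\to N$ with sides $(fh,gk)$ factors as $\alpha\circ\gamma$ for a unique cell $\gamma:M'\to M$ with sides $(h,k)$; op-Cartesian is the dual notion. $\mathbb D$ is fibrant if for all vertical $f:A\to B$, $g:C\to D$ and $M:B\nrightarrow D$ there is a Cartesian cell into $M$ with sides $(f,g)$. For $f:A\to B$, $f_*:A\nrightarrow B$ (resp. $f^*:B\nrightarrow A$) is the domain of a Cartesian cell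 into $U_B$ with sides $(f,1_B)$ (resp. $(1_B,f)$). In a fibrant double category $g_*\odot M\odot f^*$ is the codomain of an op-Cartesian cell out of $M$ with sides $(f,g)$, and $g^*\odot M\odot f_*$ is the domain of a Cartesian cell into $M$ with sides $(f,g)$. $\mathbb D$ has tabulators if $U:D_0\to D_1$ has a right adjoint; i.e. for each $F:A\nrightarrow X$ there are an object $T$ and a cell $\iota:U_T\to F$ with sides $(q_1,q_2)$ such that every cell $\beta:U_H\to F$ equals $\iota\circ U_b$ for a unique vertical $b:H\to T$. For $\mathbb D$ fibrant, the tabulators are strong if for every $F$ the globular cell ${q_2}_*\odot q_1^*\to F$ induced by $\iota$ via the universal property of the op-Cartesian cell $U_T\to{q_2}_*\odot q_1^*$ is invertible. Beck-Chevalley condition: for every pullback square $fq_1=gq_2$ in $D_0$ with $q_1:P\to A$, $q_2:P\to B$, $f:A\to C$, $g:B\to C$, the globular cell $\mathcal Y(q_1,q_2,f,g):q_{2*}\odot q_1^*\to g^*\odot f_*$, induced from $U_{fq_1}=U_{gq_2}:U_P\to U_C$ by the universal properties of the op-Cartesian cell $U_P\to q_{2*}\odot q_1^*$ (sides $(q_1,q_2)$) and the Cartesian cell $g^*\odot f_*\to U_C$ (sides $(f,g)$), is invertible. *)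

theory Defs
  imports Main
begin

section \<open>Categories and functors\<close>

text \<open>In \<open>g \<cdot>\<^bsub>C\<^esub> f\<close>, the arrow \<open>f\<close> comes first.
  All operations are total functions; only their values on the carriers \<open>Obj\<close> and \<open>Arr\<close> matter.\<close>

record ('o, 'a) cat =
  Obj :: "'o set"
  Arr :: "'a set"
  Dom :: "'a \<Rightarrow> 'o"
  Cod :: "'a \<Rightarrow> 'o"
  Id :: "'o \<Rightarrow> 'a"
  Comp :: "'a \<Rightarrow> 'a \<Rightarrow> 'a"  (infixr "\<cdot>\<index>" 75)

definition hom :: "('o, 'a) cat \<Rightarrow> 'o \<Rightarrow> 'o \<Rightarrow> 'a set" where
  "hom C A B = {f \<in> Arr C. Dom C f = A \<and> Cod C f = B}"

locale category =
  fixes C :: "('o, 'a) cat" (structure)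
  assumes Dom_Obj: "f \<in> Arr C \<Longrightarrow> Dom C f \<in> Obj C"
    and Cod_Obj: "f \<in> Arr C \<Longrightarrow> Cod C f \<in> Obj C"
    and Id_hom: "A \<in> Obj C \<Longrightarrow> Id C A \<in> hom C A A"
    and Comp_hom: "f \<in> hom C A B \<Longrightarrow> g \<in> hom C B E \<Longrightarrow> g \<cdot> f \<in> hom C A E"
    and Comp_Id: "f \<in> hom C A B \<Longrightarrow> f \<cdot> Id C A = f"
    and Id_Comp: "f \<in> hom C A B \<Longrightarrow> Id C B \<cdot> f = f"
    and Comp_assoc: "f \<in> hom C A B \<Longrightarrow> g \<in> hom C B E \<Longrightarrow> h \<in> hom C E F
      \<Longrightarrow> (h \<cdot> g) \<cdot> f = h \<cdot> (g \<cdot> f)"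

definition is_iso :: "('o, 'a) cat \<Rightarrow> 'a \<Rightarrow> bool" where
  "is_iso C f \<longleftrightarrow> f \<in> Arr C \<and>
     (\<exists>g \<in> hom C (Cod C f) (Dom C f). g \<cdot>\<^bsub>C\<^esub> f = Id C (Dom C f) \<and> f \<cdot>\<^bsub>C\<^esub> g = Id C (Cod C f))"

definition is_pullback :: "('o, 'a) cat \<Rightarrow> 'a \<Rightarrow> 'a \<Rightarrow> 'a \<Rightarrow> 'a \<Rightarrow> bool" where
  "is_pullback C f g q1 q2 \<longleftrightarrow>
     (\<exists>P A B E. q1 \<in> hom C P A \<and> q2 \<in> hom C P B \<and> f \<in> hom C A E \<and> g \<in> hom C B E \<and>
        f \<cdot>\<^bsub>C\<^esub> q1 = g \<cdot>\<^bsub>C\<^esub> q2 \<and>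
        (\<forall>H h k. h \<in> hom C H A \<and> k \<in> hom C H B \<and> f \<cdot>\<^bsub>C\<^esub> h = g \<cdot>\<^bsub>C\<^esub> k \<longrightarrow>
           (\<exists>!b. b \<in> hom C H P \<and> q1 \<cdot>\<^bsub>C\<^esub> b = h \<and> q2 \<cdot>\<^bsub>C\<^esub> b = k)))"

definition has_pullbacks :: "('o, 'a) cat \<Rightarrow> bool" where
  "has_pullbacks C \<longleftrightarrow>
     (\<forall>A B E f g. f \<in> hom C A E \<and> g \<in> hom C B E \<longrightarrow> (\<exists>q1 q2. is_pullback C f g q1 q2))"

record ('o, 'a, 'p, 'b) func =
  ob :: "'o \<Rightarrow> 'p"
  ar :: "'a \<Rightarrow> 'b"

definition is_functor :: "('o, 'a) cat \<Rightarrow> ('p, 'b) cat \<Rightarrow> ('o, 'a, 'p, 'b) func \<Rightarrow> bool" where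
  "is_functor C D F \<longleftrightarrow>
     (\<forall>A \<in> Obj C. ob F A \<in> Obj D) \<and>
     (\<forall>A B. \<forall>f \<in> hom C A B. ar F f \<in> hom D (ob F A) (ob F B)) \<and>
     (\<forall>A \<in> Obj C. ar F (Id C A) = Id D (ob F A)) \<and>
     (\<forall>A B E. \<forall>f \<in> hom C A B. \<forall>g \<in> hom C B E. ar F (g \<cdot>\<^bsub>C\<^esub> f) = ar F g \<cdot>\<^bsub>D\<^esub> ar F f)"

definition full_functor :: "('o, 'a) cat \<Rightarrow> ('p, 'b) cat \<Rightarrow> ('o, 'a, 'p, 'b) func \<Rightarrow> bool" where
  "full_functor C D F \<longleftrightarrow>
     (\<forall>A \<in> Obj C. \<forall>B \<in> Obj C. \<forall>b \<in> hom D (ob F A) (ob F B). \<exists>f \<in> hom C A B. ar F f = b)"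

definition fibre_product ::
  "('o, 'a) cat \<Rightarrow> ('p, 'b) cat \<Rightarrow> ('o, 'a, 'q, 'c) func \<Rightarrow> ('p, 'b, 'q, 'c) func
     \<Rightarrow> ('o \<times> 'p, 'a \<times> 'b) cat" where
  "fibre_product A B F G =
     \<lparr> Obj = {(x, y). x \<in> Obj A \<and> y \<in> Obj B \<and> ob F x = ob G y},
       Arr = {(f, g). f \<in> Arr A \<and> g \<in> Arr B \<and> ar F f = ar G g},
       Dom = (\<lambda>(f, g). (Dom A f, Dom B g)),
       Cod = (\<lambda>(f, g). (Cod A f, Cod B g)),
       Id = (\<lambda>(x, y). (Id A x, Id B y)),
       Comp = (\<lambda>(f', g') (f, g). (f' \<cdot>\<^bsub>A\<^esub> f, g' \<cdot>\<^bsub>B\<^esub> g)) \<rparr>"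

section \<open>Pseudo double categories\<close>

text \<open>Type variables: objects \<open>'o\<close>, vertical arrows \<open>'v\<close>, horizontal arrows \<open>'h\<close>, cells \<open>'c\<close>.\<close>

record ('o, 'v, 'h, 'c) double_cat =
  D0 :: "('o, 'v) cat"
  D1 :: "('h, 'c) cat"
  Src :: "('h, 'c, 'o, 'v) func"
  Tgt :: "('h, 'c, 'o, 'v) func"
  Unit :: "('o, 'v, 'h, 'c) func"
  Hcomp :: "('h \<times> 'h, 'c \<times> 'c, 'h, 'c) func"
  Assoc :: "'h \<Rightarrow> 'h \<Rightarrow> 'h \<Rightarrow> 'c"
  Lunit :: "'h \<Rightarrow> 'c"
  Runit :: "'h \<Rightarrow> 'c"

abbreviation hcomp_ob :: "('o, 'v, 'h, 'c) double_cat \<Rightarrow> 'h \<Rightarrow> 'h \<Rightarrow> 'h" where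
  "hcomp_ob D M N \<equiv> ob (Hcomp D) (M, N)"

abbreviation hcomp_ar :: "('o, 'v, 'h, 'c) double_cat \<Rightarrow> 'c \<Rightarrow> 'c \<Rightarrow> 'c" where
  "hcomp_ar D \<alpha> \<beta> \<equiv> ar (Hcomp D) (\<alpha>, \<beta>)"

definition is_cell :: "('o, 'v, 'h, 'c) double_cat \<Rightarrow> 'c \<Rightarrow> 'h \<Rightarrow> 'h \<Rightarrow> 'v \<Rightarrow> 'v \<Rightarrow> bool" where
  "is_cell D \<alpha> M N f g \<longleftrightarrow> \<alpha> \<in> hom (D1 D) M N \<and> ar (Src D) \<alpha> = f \<and> ar (Tgt D) \<alpha> = g"

definition is_globular :: "('o, 'v, 'h, 'c) double_cat \<Rightarrow> 'c \<Rightarrow> 'h \<Rightarrow> 'h \<Rightarrow> bool" where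
  "is_globular D \<alpha> M N \<longleftrightarrow>
     is_cell D \<alpha> M N (Id (D0 D) (ob (Src D) M)) (Id (D0 D) (ob (Tgt D) M))"

locale double_category =
  fixes D :: "('o, 'v, 'h, 'c) double_cat"
  assumes D0_category: "category (D0 D)"
    and D1_category: "category (D1 D)"
    and Src_functor: "is_functor (D1 D) (D0 D) (Src D)"
    and Tgt_functor: "is_functor (D1 D) (D0 D) (Tgt D)"
    and Unit_functor: "is_functor (D0 D) (D1 D) (Unit D)"
    and Hcomp_functor:
      "is_functor (fibre_product (D1 D) (D1 D) (Src D) (Tgt D)) (D1 D) (Hcomp D)"
    and Src_Unit_ob: "A \<in> Obj (D0 D) \<Longrightarrow> ob (Src D) (ob (Unit D) A) = A"
    and Src_Unit_ar: "f \<in> Arr (D0 D) \<Longrightarrow> ar (Src D) (ar (Unit D) f) = f"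
    and Tgt_Unit_ob: "A \<in> Obj (D0 D) \<Longrightarrow> ob (Tgt D) (ob (Unit D) A) = A"
    and Tgt_Unit_ar: "f \<in> Arr (D0 D) \<Longrightarrow> ar (Tgt D) (ar (Unit D) f) = f"
    and Src_Hcomp_ob: "\<lbrakk>M \<in> Obj (D1 D); N \<in> Obj (D1 D); ob (Src D) M = ob (Tgt D) N\<rbrakk>
      \<Longrightarrow> ob (Src D) (hcomp_ob D M N) = ob (Src D) N"
    and Src_Hcomp_ar: "\<lbrakk>\<alpha> \<in> Arr (D1 D); \<beta> \<in> Arr (D1 D); ar (Src D) \<alpha> = ar (Tgt D) \<beta>\<rbrakk>
      \<Longrightarrow> ar (Src D) (hcomp_ar D \<alpha> \<beta>) = ar (Src D) \<beta>"
    and Tgt_Hcomp_ob: "\<lbrakk>M \<in> Obj (D1 D); N \<in> Obj (D1 D); ob (Src D) M = ob (Tgt D) N\<rbrakk>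
      \<Longrightarrow> ob (Tgt D) (hcomp_ob D M N) = ob (Tgt D) M"
    and Tgt_Hcomp_ar: "\<lbrakk>\<alpha> \<in> Arr (D1 D); \<beta> \<in> Arr (D1 D); ar (Src D) \<alpha> = ar (Tgt D) \<beta>\<rbrakk>
      \<Longrightarrow> ar (Tgt D) (hcomp_ar D \<alpha> \<beta>) = ar (Tgt D) \<alpha>"
    and Assoc_globular: "\<lbrakk>M \<in> Obj (D1 D); N \<in> Obj (D1 D); P \<in> Obj (D1 D);
        ob (Src D) M = ob (Tgt D) N; ob (Src D) N = ob (Tgt D) P\<rbrakk>
      \<Longrightarrow> is_globular D (Assoc D M N P)
            (hcomp_ob D (hcomp_ob D M N) P) (hcomp_ob D M (hcomp_ob D N P))"
    and Assoc_iso: "\<lbrakk>M \<in> Obj (D1 D); N \<in> Obj (D1 D); P \<in> Obj (D1 D);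
        ob (Src D) M = ob (Tgt D) N; ob (Src D) N = ob (Tgt D) P\<rbrakk>
      \<Longrightarrow> is_iso (D1 D) (Assoc D M N P)"
    and Assoc_natural: "\<lbrakk>\<alpha> \<in> hom (D1 D) M M'; \<beta> \<in> hom (D1 D) N N'; \<gamma> \<in> hom (D1 D) P P';
        ar (Src D) \<alpha> = ar (Tgt D) \<beta>; ar (Src D) \<beta> = ar (Tgt D) \<gamma>\<rbrakk>
      \<Longrightarrow> Assoc D M' N' P' \<cdot>\<^bsub>D1 D\<^esub> hcomp_ar D (hcomp_ar D \<alpha> \<beta>) \<gamma>
          = hcomp_ar D \<alpha> (hcomp_ar D \<beta> \<gamma>) \<cdot>\<^bsub>D1 D\<^esub> Assoc D M N P"
    and Lunit_globular: "M \<in> Obj (D1 D)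
      \<Longrightarrow> is_globular D (Lunit D M) (hcomp_ob D (ob (Unit D) (ob (Tgt D) M)) M) M"
    and Lunit_iso: "M \<in> Obj (D1 D) \<Longrightarrow> is_iso (D1 D) (Lunit D M)"
    and Lunit_natural: "\<alpha> \<in> hom (D1 D) M M'
      \<Longrightarrow> Lunit D M' \<cdot>\<^bsub>D1 D\<^esub> hcomp_ar D (ar (Unit D) (ar (Tgt D) \<alpha>)) \<alpha> = \<alpha> \<cdot>\<^bsub>D1 D\<^esub> Lunit D M"
    and Runit_globular: "M \<in> Obj (D1 D)
      \<Longrightarrow> is_globular D (Runit D M) (hcomp_ob D M (ob (Unit D) (ob (Src D) M))) M"
    and Runit_iso: "M \<in> Obj (D1 D) \<Longrightarrow> is_iso (D1 D) (Runit D M)"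
    and Runit_natural: "\<alpha> \<in> hom (D1 D) M M'
      \<Longrightarrow> Runit D M' \<cdot>\<^bsub>D1 D\<^esub> hcomp_ar D \<alpha> (ar (Unit D) (ar (Src D) \<alpha>)) = \<alpha> \<cdot>\<^bsub>D1 D\<^esub> Runit D M"
    and pentagon: "\<lbrakk>M \<in> Obj (D1 D); N \<in> Obj (D1 D); P \<in> Obj (D1 D); Q \<in> Obj (D1 D);
        ob (Src D) M = ob (Tgt D) N; ob (Src D) N = ob (Tgt D) P; ob (Src D) P = ob (Tgt D) Q\<rbrakk>
      \<Longrightarrow> Assoc D M N (hcomp_ob D P Q) \<cdot>\<^bsub>D1 D\<^esub> Assoc D (hcomp_ob D M N) P Q
          = hcomp_ar D (Id (D1 D) M) (Assoc D N P Q) \<cdot>\<^bsub>D1 D\<^esub> Assoc D M (hcomp_ob D N P) Q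
              \<cdot>\<^bsub>D1 D\<^esub> hcomp_ar D (Assoc D M N P) (Id (D1 D) Q)"
    and triangle: "\<lbrakk>M \<in> Obj (D1 D); N \<in> Obj (D1 D); ob (Src D) M = ob (Tgt D) N\<rbrakk>
      \<Longrightarrow> hcomp_ar D (Id (D1 D) M) (Lunit D N) \<cdot>\<^bsub>D1 D\<^esub> Assoc D M (ob (Unit D) (ob (Src D) M)) N
          = hcomp_ar D (Runit D M) (Id (D1 D) N)"

definition unit_pure :: "('o, 'v, 'h, 'c) double_cat \<Rightarrow> bool" where
  "unit_pure D \<longleftrightarrow> full_functor (D0 D) (D1 D) (Unit D)"

section \<open>Cartesian cells, fibrancy, companions and conjoints\<close>

definition is_cartesian ::
  "('o, 'v, 'h, 'c) double_cat \<Rightarrow> 'c \<Rightarrow> 'h \<Rightarrow> 'h \<Rightarrow> 'v \<Rightarrow> 'v \<Rightarrow> bool" where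
  "is_cartesian D \<alpha> M N f g \<longleftrightarrow> is_cell D \<alpha> M N f g \<and>
     (\<forall>M' h k \<beta>. h \<in> Arr (D0 D) \<and> k \<in> Arr (D0 D) \<and>
        Cod (D0 D) h = Dom (D0 D) f \<and> Cod (D0 D) k = Dom (D0 D) g \<and>
        is_cell D \<beta> M' N (f \<cdot>\<^bsub>D0 D\<^esub> h) (g \<cdot>\<^bsub>D0 D\<^esub> k) \<longrightarrow>
        (\<exists>!\<gamma>. is_cell D \<gamma> M' M h k \<and> \<alpha> \<cdot>\<^bsub>D1 D\<^esub> \<gamma> = \<beta>))"

definition is_op_cartesian ::
  "('o, 'v, 'h, 'c) double_cat \<Rightarrow> 'c \<Rightarrow> 'h \<Rightarrow> 'h \<Rightarrow> 'v \<Rightarrow> 'v \<Rightarrow> bool" where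
  "is_op_cartesian D \<alpha> M N f g \<longleftrightarrow> is_cell D \<alpha> M N f g \<and>
     (\<forall>N' h k \<beta>. h \<in> Arr (D0 D) \<and> k \<in> Arr (D0 D) \<and>
        Dom (D0 D) h = Cod (D0 D) f \<and> Dom (D0 D) k = Cod (D0 D) g \<and>
        is_cell D \<beta> M N' (h \<cdot>\<^bsub>D0 D\<^esub> f) (k \<cdot>\<^bsub>D0 D\<^esub> g) \<longrightarrow>
        (\<exists>!\<gamma>. is_cell D \<gamma> N N' h k \<and> \<gamma> \<cdot>\<^bsub>D1 D\<^esub> \<alpha> = \<beta>))"

definition fibrant :: "('o, 'v, 'h, 'c) double_cat \<Rightarrow> bool" where
  "fibrant D \<longleftrightarrow>
     (\<forall>f \<in> Arr (D0 D). \<forall>g \<in> Arr (D0 D). \<forall>M \<in> Obj (D1 D).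
        ob (Src D) M = Cod (D0 D) f \<and> ob (Tgt D) M = Cod (D0 D) g \<longrightarrow>
        (\<exists>\<alpha> N. is_cartesian D \<alpha> N M f g))"

text \<open>\<open>is_companion D f M\<close> says that \<open>M\<close> is an \<open>f\<^sub>*\<close>, and \<open>is_conjoint D f M\<close> that \<open>M\<close> is an \<open>f\<^sup>*\<close>.
  Both are determined only up to globular isomorphism, so they are treated as relations
  and everything below quantifies over all choices.\<close>

definition is_companion :: "('o, 'v, 'h, 'c) double_cat \<Rightarrow> 'v \<Rightarrow> 'h \<Rightarrow> bool" where
  "is_companion D f M \<longleftrightarrow> f \<in> Arr (D0 D) \<and>
     (\<exists>\<alpha>. is_cartesian D \<alpha> M (ob (Unit D) (Cod (D0 D) f)) f (Id (D0 D) (Cod (D0 D) f)))"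

definition is_conjoint :: "('o, 'v, 'h, 'c) double_cat \<Rightarrow> 'v \<Rightarrow> 'h \<Rightarrow> bool" where
  "is_conjoint D f M \<longleftrightarrow> f \<in> Arr (D0 D) \<and>
     (\<exists>\<alpha>. is_cartesian D \<alpha> M (ob (Unit D) (Cod (D0 D) f)) (Id (D0 D) (Cod (D0 D) f)) f)"

section \<open>Tabulators\<close>

definition is_tabulator :: "('o, 'v, 'h, 'c) double_cat \<Rightarrow> 'h \<Rightarrow> 'o \<Rightarrow> 'c \<Rightarrow> bool" where
  "is_tabulator D F T \<iota> \<longleftrightarrow> T \<in> Obj (D0 D) \<and> \<iota> \<in> hom (D1 D) (ob (Unit D) T) F \<and>
     (\<forall>H \<in> Obj (D0 D). \<forall>\<beta> \<in> hom (D1 D) (ob (Unit D) H) F.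
        \<exists>!b. b \<in> hom (D0 D) H T \<and> \<iota> \<cdot>\<^bsub>D1 D\<^esub> ar (Unit D) b = \<beta>)"

definition has_tabulators :: "('o, 'v, 'h, 'c) double_cat \<Rightarrow> bool" where
  "has_tabulators D \<longleftrightarrow> (\<forall>F \<in> Obj (D1 D). \<exists>T \<iota>. is_tabulator D F T \<iota>)"

text \<open>Below, \<open>q1 = S \<iota>\<close> and \<open>q2 = T \<iota>\<close>. The description operator is used only where
  (op-)Cartesianness gives existence and uniqueness of the described globular cell.\<close>

definition strong_tabulators :: "('o, 'v, 'h, 'c) double_cat \<Rightarrow> bool" where
  "strong_tabulators D \<longleftrightarrow>
     (\<forall>F \<in> Obj (D1 D). \<forall>T \<iota> q1 q2 M N u.
        is_tabulator D F T \<iota> \<and> is_cell D \<iota> (ob (Unit D) T) F q1 q2 \<and>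
        is_companion D q2 M \<and> is_conjoint D q1 N \<and>
        is_op_cartesian D u (ob (Unit D) T) (hcomp_ob D M N) q1 q2 \<longrightarrow>
        is_iso (D1 D) (THE y. is_globular D y (hcomp_ob D M N) F \<and> y \<cdot>\<^bsub>D1 D\<^esub> u = \<iota>))"

section \<open>The Beck-Chevalley condition\<close>

text \<open>\<open>comparison_cell D M N u c \<theta>\<close> is the globular cell \<open>M \<rightarrow> N\<close> induced by a cell \<open>\<theta>\<close>, an
  op-Cartesian cell \<open>u\<close> into \<open>M\<close> and a Cartesian cell \<open>c\<close> out of \<open>N\<close>.\<close>

definition comparison_cell ::
  "('o, 'v, 'h, 'c) double_cat \<Rightarrow> 'h \<Rightarrow> 'h \<Rightarrow> 'c \<Rightarrow> 'c \<Rightarrow> 'c \<Rightarrow> 'c" where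
  "comparison_cell D M N u c \<theta> =
     (THE y. is_globular D y M N \<and> c \<cdot>\<^bsub>D1 D\<^esub> y \<cdot>\<^bsub>D1 D\<^esub> u = \<theta>)"

text \<open>The roles are \<open>Mq = q2\<^sub>*\<close>, \<open>Nq = q1\<^sup>*\<close>, \<open>Mg = g\<^sup>*\<close>, \<open>Nf = f\<^sub>*\<close>. The two existence clauses
  hold in every fibrant double category; they are included so that the condition, which
  ranges over all choices of the universal cells \<open>u\<close> and \<open>c\<close>, is never vacuous.\<close>

definition beck_chevalley :: "('o, 'v, 'h, 'c) double_cat \<Rightarrow> bool" where
  "beck_chevalley D \<longleftrightarrow>
     (\<forall>f g q1 q2 Mq Nq Mg Nf.
        is_pullback (D0 D) f g q1 q2 \<and>
        is_companion D q2 Mq \<and> is_conjoint D q1 Nq \<and>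
        is_conjoint D g Mg \<and> is_companion D f Nf \<longrightarrow>
        (let UP = ob (Unit D) (Dom (D0 D) q1); UC = ob (Unit D) (Cod (D0 D) f);
             V = hcomp_ob D Mq Nq; W = hcomp_ob D Mg Nf
         in (\<exists>u. is_op_cartesian D u UP V q1 q2) \<and>
            (\<exists>c. is_cartesian D c W UC f g) \<and>
            (\<forall>u c. is_op_cartesian D u UP V q1 q2 \<and> is_cartesian D c W UC f g \<longrightarrow>
               is_iso (D1 D) (comparison_cell D V W u c (ar (Unit D) (f \<cdot>\<^bsub>D0 D\<^esub> q1))))))"

end

theory Submission
  imports Defs
begin

text \<open>By unit-purity a cell \<open>U\<^sub>H \<rightarrow> U\<^sub>C\<close> is the same as an arrow \<open>H \<rightarrow> C\<close>, so for a Cartesian cell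
  \<open>F \<rightarrow> U\<^sub>C\<close> with sides \<open>(f, g)\<close>, cells \<open>U\<^sub>H \<rightarrow> F\<close> with sides \<open>(h, k)\<close> exist, uniquely, exactly when
  \<open>fh = gk\<close>. Hence a tabulator of \<open>F\<close> is the same as a pullback of \<open>f\<close> and \<open>g\<close>. Taking
  \<open>F = g\<^sup>* \<odot> f\<^sub>*\<close>, the comparison cell of a pullback square is the cell induced by a tabulator,
  so it is invertible when tabulators are strong.

  The universal cells \<open>U\<^sub>P \<rightarrow> q\<^sub>* \<odot> p\<^sup>*\<close> and \<open>g\<^sup>* \<odot> f\<^sub>* \<rightarrow> U\<^sub>C\<close> are composites of the units and counits
  of the companions and conjoints. In the proofs of uniqueness, no composite of these has to be
  computed: it is enough to know that the companion and conjoint identities exhibit certain cells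
  as invertible, and to cancel them. This avoids the pentagon and triangle axioms.\<close>

section \<open>Cells with sides under vertical and horizontal composition\<close>

context double_category
begin

sublocale V: category "D0 D" by (rule D0_category)
sublocale H: category "D1 D" by (rule D1_category)

abbreviation vid ("\<one>") where "\<one> \<equiv> Id (D0 D)"
abbreviation cid ("\<one>\<^sub>1") where "\<one>\<^sub>1 \<equiv> Id (D1 D)"
abbreviation vcomp (infixr "\<Zsemi>" 75) where "g \<Zsemi> f \<equiv> g \<cdot>\<^bsub>D0 D\<^esub> f"
abbreviation ccomp (infixr "\<bullet>" 75) where "\<beta> \<bullet> \<alpha> \<equiv> \<beta> \<cdot>\<^bsub>D1 D\<^esub> \<alpha>"
abbreviation hob (infixr "\<otimes>" 76) where "M \<otimes> N \<equiv> hcomp_ob D M N"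
abbreviation har (infixr "\<odot>" 76) where "\<alpha> \<odot> \<beta> \<equiv> hcomp_ar D \<alpha> \<beta>"
abbreviation "S \<equiv> ob (Src D)"
abbreviation "T \<equiv> ob (Tgt D)"
abbreviation "U \<equiv> ob (Unit D)"
abbreviation "U\<^sub>1 \<equiv> ar (Unit D)"
abbreviation "cell \<equiv> is_cell D"

lemma cell_hom: "cell \<alpha> M N f g \<Longrightarrow> \<alpha> \<in> hom (D1 D) M N"
  by (simp add: is_cell_def)

lemma cell_Obj:
  assumes "cell \<alpha> M N f g"
  shows "M \<in> Obj (D1 D)" "N \<in> Obj (D1 D)"
  using assms H.Dom_Obj H.Cod_Obj by (auto simp: is_cell_def hom_def)

lemma cell_Src: "cell \<alpha> M N f g \<Longrightarrow> f \<in> hom (D0 D) (S M) (S N)"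
  using Src_functor by (auto simp: is_cell_def is_functor_def)

lemma cell_Tgt: "cell \<alpha> M N f g \<Longrightarrow> g \<in> hom (D0 D) (T M) (T N)"
  using Tgt_functor by (auto simp: is_cell_def is_functor_def)

lemma Src_Obj: "M \<in> Obj (D1 D) \<Longrightarrow> S M \<in> Obj (D0 D)"
  using Src_functor by (auto simp: is_functor_def)

lemma Tgt_Obj: "M \<in> Obj (D1 D) \<Longrightarrow> T M \<in> Obj (D0 D)"
  using Tgt_functor by (auto simp: is_functor_def)

lemma Unit_Obj: "A \<in> Obj (D0 D) \<Longrightarrow> U A \<in> Obj (D1 D)"
  using Unit_functor by (auto simp: is_functor_def)

text \<open>The sides of the composite are variables tied by equations, so that a use can state them
  with identities already absorbed.\<close>

lemma cell_comp:
  assumes "cell \<alpha> M N f g" "cell \<beta> N P h k" "p = h \<Zsemi> f" "q = k \<Zsemi> g"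
  shows "cell (\<beta> \<bullet> \<alpha>) M P p q"
  using assms Src_functor Tgt_functor H.Comp_hom
  by (auto simp: is_cell_def is_functor_def)

lemma cell_cid: "M \<in> Obj (D1 D) \<Longrightarrow> cell (\<one>\<^sub>1 M) M M (\<one> (S M)) (\<one> (T M))"
  using Src_functor Tgt_functor H.Id_hom by (auto simp: is_cell_def is_functor_def)

lemma cell_Unit: "f \<in> hom (D0 D) A B \<Longrightarrow> cell (U\<^sub>1 f) (U A) (U B) f f"
  using Unit_functor Src_Unit_ar Tgt_Unit_ar by (auto simp: is_cell_def is_functor_def hom_def)

lemma Unit_comp:
  "f \<in> hom (D0 D) A B \<Longrightarrow> g \<in> hom (D0 D) B E \<Longrightarrow> U\<^sub>1 (g \<Zsemi> f) = U\<^sub>1 g \<bullet> U\<^sub>1 f"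
  using Unit_functor by (auto simp: is_functor_def)

lemma Unit_vid: "A \<in> Obj (D0 D) \<Longrightarrow> U\<^sub>1 (\<one> A) = \<one>\<^sub>1 (U A)"
  using Unit_functor by (auto simp: is_functor_def)

lemma comp_vid:
  assumes "f \<in> hom (D0 D) A B"
  shows "f \<Zsemi> \<one> A = f" "\<one> B \<Zsemi> f = f"
  using assms V.Comp_Id V.Id_Comp by auto

lemma cell_comp_cid:
  assumes "cell \<alpha> M N f g"
  shows "\<alpha> \<bullet> \<one>\<^sub>1 M = \<alpha>" "\<one>\<^sub>1 N \<bullet> \<alpha> = \<alpha>"
  using assms H.Comp_Id H.Id_Comp by (auto simp: is_cell_def)

lemma cell_assoc:
  "cell \<alpha> M N f g \<Longrightarrow> cell \<beta> N P f' g' \<Longrightarrow> cell \<gamma> P Q f'' g''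
    \<Longrightarrow> (\<gamma> \<bullet> \<beta>) \<bullet> \<alpha> = \<gamma> \<bullet> (\<beta> \<bullet> \<alpha>)"
  using H.Comp_assoc by (auto simp: is_cell_def)

lemma hcomp_pair_hom:
  assumes "cell \<alpha> M N f g" "cell \<beta> P Q e f"
  shows "(\<alpha>, \<beta>) \<in> hom (fibre_product (D1 D) (D1 D) (Src D) (Tgt D)) (M, P) (N, Q)"
  using assms by (auto simp: is_cell_def hom_def fibre_product_def)

lemma cell_hcomp:
  assumes "cell \<alpha> M N f g" "cell \<beta> P Q e f"
  shows "cell (\<alpha> \<odot> \<beta>) (M \<otimes> P) (N \<otimes> Q) e g"
proof -
  have "\<alpha> \<odot> \<beta> \<in> hom (D1 D) (M \<otimes> P) (N \<otimes> Q)"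
    using hcomp_pair_hom[OF assms] Hcomp_functor unfolding is_functor_def by blast
  moreover have "\<alpha> \<in> Arr (D1 D)" "\<beta> \<in> Arr (D1 D)" "ar (Src D) \<alpha> = ar (Tgt D) \<beta>"
    using assms by (auto simp: is_cell_def hom_def)
  ultimately show ?thesis
    using assms Src_Hcomp_ar Tgt_Hcomp_ar by (auto simp: is_cell_def)
qed

lemma interchange:
  assumes "cell \<alpha> M N f g" "cell \<beta> P Q e f" "cell \<alpha>' N N' f' g'" "cell \<beta>' Q Q' e' f'"
  shows "(\<alpha>' \<odot> \<beta>') \<bullet> (\<alpha> \<odot> \<beta>) = (\<alpha>' \<bullet> \<alpha>) \<odot> (\<beta>' \<bullet> \<beta>)"
proof -
  let ?F = "fibre_product (D1 D) (D1 D) (Src D) (Tgt D)"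
  have "ar (Hcomp D) ((\<alpha>', \<beta>') \<cdot>\<^bsub>?F\<^esub> (\<alpha>, \<beta>)) = (\<alpha>' \<odot> \<beta>') \<bullet> (\<alpha> \<odot> \<beta>)"
    using hcomp_pair_hom[OF assms(1,2)] hcomp_pair_hom[OF assms(3,4)] Hcomp_functor
    unfolding is_functor_def by blast
  then show ?thesis
    by (simp add: fibre_product_def)
qed

lemma hcomp_Obj:
  assumes "M \<in> Obj (D1 D)" "N \<in> Obj (D1 D)" "S M = T N"
  shows "M \<otimes> N \<in> Obj (D1 D)"
  using assms Hcomp_functor by (auto simp: is_functor_def fibre_product_def)

lemma hcomp_cid:
  assumes "M \<in> Obj (D1 D)" "N \<in> Obj (D1 D)" "S M = T N"
  shows "\<one>\<^sub>1 M \<odot> \<one>\<^sub>1 N = \<one>\<^sub>1 (M \<otimes> N)"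
  using assms Hcomp_functor by (auto simp: is_functor_def fibre_product_def)

lemma Lunit_nat: 
  "cell \<alpha> M N f g \<Longrightarrow> Lunit D N \<bullet> (U\<^sub>1 g \<odot> \<alpha>) = \<alpha> \<bullet> Lunit D M"
  using Lunit_natural by (auto simp: is_cell_def)

lemma Runit_nat: 
  "cell \<alpha> M N f g \<Longrightarrow> Runit D N \<bullet> (\<alpha> \<odot> U\<^sub>1 f) = \<alpha> \<bullet> Runit D M"
  using Runit_natural by (auto simp: is_cell_def)

lemma Assoc_nat:
  assumes "cell \<alpha> M M' f g" "cell \<beta> N N' e f" "cell \<gamma> P P' d e"
  shows "Assoc D M' N' P' \<bullet> ((\<alpha> \<odot> \<beta>) \<odot> \<gamma>) = (\<alpha> \<odot> (\<beta> \<odot> \<gamma>)) \<bullet> Assoc D M N P"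
  using assms Assoc_natural by (auto simp: is_cell_def)

section \<open>Invertible globular cells\<close>

text \<open>The inverse is an argument, so that cancellation can name it. Unlike
  \<open>is_iso\<close>, the definition asks the inverse to be globular as well.\<close>

definition giso :: "'c \<Rightarrow> 'h \<Rightarrow> 'h \<Rightarrow> 'c \<Rightarrow> bool" where
  "giso \<alpha> M N \<beta> \<longleftrightarrow> is_globular D \<alpha> M N \<and> is_globular D \<beta> N M \<and>
     \<beta> \<bullet> \<alpha> = \<one>\<^sub>1 M \<and> \<alpha> \<bullet> \<beta> = \<one>\<^sub>1 N"

lemma globular_ends:
  assumes "is_globular D \<alpha> M N"
  shows "S N = S M" "T N = T M"
proof -
  have M: "M \<in> Obj (D1 D)" using assms cell_Obj by (auto simp: is_globular_def)
  have "\<one> (S M) \<in> hom (D0 D) (S M) (S N)" "\<one> (T M) \<in> hom (D0 D) (T M) (T N)"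
    using assms cell_Src cell_Tgt by (auto simp: is_globular_def)
  then show "S N = S M" "T N = T M"
    using V.Id_hom[OF Src_Obj[OF M]] V.Id_hom[OF Tgt_Obj[OF M]] by (auto simp: hom_def)
qed

lemma giso_sym: "giso \<alpha> M N \<beta> \<Longrightarrow> giso \<beta> N M \<alpha>"
  by (auto simp: giso_def)

lemma giso_cell:
  assumes "giso \<alpha> M N \<beta>"
  shows "cell \<alpha> M N (\<one> (S M)) (\<one> (T M))" "cell \<beta> N M (\<one> (S M)) (\<one> (T M))"
    "\<beta> \<bullet> \<alpha> = \<one>\<^sub>1 M" "\<alpha> \<bullet> \<beta> = \<one>\<^sub>1 N" "S N = S M" "T N = T M"
  using assms globular_ends[of \<alpha> M N] by (auto simp: giso_def is_globular_def)

text \<open>An inverse in \<open>D1 D\<close> is automatically globular: since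
  \<open>\<alpha>\<close> has identity sides, \<open>\<beta> \<bullet> \<alpha>\<close> has the
  sides of \<open>\<beta>\<close>, and this composite is an identity cell.\<close>

lemma gisoI:
  assumes "is_globular D \<alpha> M N" "is_iso (D1 D) \<alpha>"
  shows "\<exists>\<beta>. giso \<alpha> M N \<beta>"
proof -
  have a: "cell \<alpha> M N (\<one> (S M)) (\<one> (T M))" using assms by (simp add: is_globular_def)
  note ends = globular_ends[OF assms(1)]
  obtain \<beta> where b: "\<beta> \<in> hom (D1 D) N M" "\<beta> \<bullet> \<alpha> = \<one>\<^sub>1 M" "\<alpha> \<bullet> \<beta> = \<one>\<^sub>1 N"
    using assms a by (auto simp: is_iso_def is_cell_def hom_def)
  then have c: "cell \<beta> N M (ar (Src D) \<beta>) (ar (Tgt D) \<beta>)" by (simp add: is_cell_def)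
  have "cell (\<beta> \<bullet> \<alpha>) M M (ar (Src D) \<beta>) (ar (Tgt D) \<beta>)"
    using cell_Src[OF c] cell_Tgt[OF c] ends
    by (intro cell_comp[OF a c]) (simp_all add: comp_vid)
  moreover have "cell (\<beta> \<bullet> \<alpha>) M M (\<one> (S M)) (\<one> (T M))"
    unfolding b using cell_cid a cell_Obj by blast
  ultimately have "cell \<beta> N M (\<one> (S M)) (\<one> (T M))"
    using c by (auto simp: is_cell_def)
  then show ?thesis
    using assms b ends by (auto simp: giso_def is_globular_def)
qed

lemma giso_comp:
  assumes "giso \<alpha> M N \<alpha>'" "giso \<beta> N P \<beta>'"
  shows "giso (\<beta> \<bullet> \<alpha>) M P (\<alpha>' \<bullet> \<beta>')"
proof -
  note a = giso_cell[OF assms(1)] and b = giso_cell[OF assms(2)]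
  have idS: "\<one> (S M) \<Zsemi> \<one> (S M) = \<one> (S M)" "\<one> (T M) \<Zsemi> \<one> (T M) = \<one> (T M)"
    using V.Id_hom Src_Obj Tgt_Obj comp_vid cell_Obj(1)[OF a(1)] by blast+
  have c: "cell (\<beta> \<bullet> \<alpha>) M P (\<one> (S M)) (\<one> (T M))" "cell (\<alpha>' \<bullet> \<beta>') P M (\<one> (S M)) (\<one> (T M))"
    using a b idS by (auto intro!: cell_comp[of \<alpha> M N] cell_comp[of \<beta>' P N])
  have "(\<alpha>' \<bullet> \<beta>') \<bullet> (\<beta> \<bullet> \<alpha>) = \<alpha>' \<bullet> ((\<beta>' \<bullet> \<beta>) \<bullet> \<alpha>)"
    using cell_assoc[OF c(1) b(2) a(2)] cell_assoc[OF a(1) b(1,2)] by simp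
  moreover have "(\<beta> \<bullet> \<alpha>) \<bullet> (\<alpha>' \<bullet> \<beta>') = \<beta> \<bullet> ((\<alpha> \<bullet> \<alpha>') \<bullet> \<beta>')"
    using cell_assoc[OF c(2) a(1) b(1)] cell_assoc[OF b(2) a(2,1)] by simp
  ultimately show ?thesis
    using a b c cell_comp_cid(2)[OF a(1)] cell_comp_cid(2)[OF b(2)]
    by (auto simp: giso_def is_globular_def)
qed

lemma giso_cid: "M \<in> Obj (D1 D) \<Longrightarrow> giso (\<one>\<^sub>1 M) M M (\<one>\<^sub>1 M)"
  using cell_cid[of M] cell_comp_cid[OF cell_cid[of M]] by (simp add: giso_def is_globular_def)

lemma giso_hcomp:
  assumes "giso \<alpha> M N \<alpha>'" "giso \<beta> P Q \<beta>'" "S M = T P"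
  shows "giso (\<alpha> \<odot> \<beta>) (M \<otimes> P) (N \<otimes> Q) (\<alpha>' \<odot> \<beta>')"
proof -
  note a = giso_cell[OF assms(1)] and b = giso_cell[OF assms(2)]
  note o = cell_Obj[OF a(1)] cell_Obj[OF b(1)]
  have ends: "S (M \<otimes> P) = S P" "T (M \<otimes> P) = T M" "S (N \<otimes> Q) = S P" "T (N \<otimes> Q) = T M"
    using Src_Hcomp_ob Tgt_Hcomp_ob o a b assms by auto
  have c: "cell (\<alpha> \<odot> \<beta>) (M \<otimes> P) (N \<otimes> Q) (\<one> (S P)) (\<one> (T M))"
    "cell (\<alpha>' \<odot> \<beta>') (N \<otimes> Q) (M \<otimes> P) (\<one> (S P)) (\<one> (T M))"
    using a b assms by (auto intro!: cell_hcomp)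
  have "(\<alpha>' \<odot> \<beta>') \<bullet> (\<alpha> \<odot> \<beta>) = \<one>\<^sub>1 (M \<otimes> P)"
    using interchange[OF a(1) b(1)[folded assms(3)] a(2) b(2)[folded assms(3)]]
      a(3) b(3) hcomp_cid[OF o(1,3) assms(3)] by simp
  moreover have "(\<alpha> \<odot> \<beta>) \<bullet> (\<alpha>' \<odot> \<beta>') = \<one>\<^sub>1 (N \<otimes> Q)"
    using interchange[OF a(2) b(2)[folded assms(3)] a(1) b(1)[folded assms(3)]]
      a(4-6) b(4-6) hcomp_cid[OF o(2,4)] assms(3) by simp
  ultimately show ?thesis using c ends by (auto simp: giso_def is_globular_def)
qed

lemma giso_cancel:
  assumes "giso \<alpha> M N \<alpha>'" "cell \<beta> P M f g"
  shows "\<alpha>' \<bullet> (\<alpha> \<bullet> \<beta>) = \<beta>"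
proof -
  note a = giso_cell[OF assms(1)]
  show ?thesis
    unfolding cell_assoc[OF assms(2) a(1,2), symmetric] a(3) by (rule cell_comp_cid[OF assms(2)])
qed

lemma giso_cancel_right:
  assumes "giso \<alpha> M N \<alpha>'" "cell \<beta> N P f g"
  shows "(\<beta> \<bullet> \<alpha>) \<bullet> \<alpha>' = \<beta>"
proof -
  note a = giso_cell[OF assms(1)]
  show ?thesis
    unfolding cell_assoc[OF a(2,1) assms(2)] a(4) by (rule cell_comp_cid[OF assms(2)])
qed

lemma giso_mono:
  assumes "giso \<alpha> M N \<alpha>'" "cell \<beta> P M f g" "cell \<gamma> P M h k" "\<alpha> \<bullet> \<beta> = \<alpha> \<bullet> \<gamma>"
  shows "\<beta> = \<gamma>"
  using giso_cancel[OF assms(1,2)] giso_cancel[OF assms(1,3)] unfolding assms(4) by (rule subst)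

lemma giso_epi:
  assumes "giso \<alpha> M N \<alpha>'" "cell \<beta> N P f g" "cell \<gamma> N P h k" "\<beta> \<bullet> \<alpha> = \<gamma> \<bullet> \<alpha>"
  shows "\<beta> = \<gamma>"
  using giso_cancel_right[OF assms(1,2)] giso_cancel_right[OF assms(1,3)] unfolding assms(4)
  by (rule subst)

lemma giso_Lunit: "M \<in> Obj (D1 D) \<Longrightarrow> \<exists>\<beta>. giso (Lunit D M) (U (T M) \<otimes> M) M \<beta>"
  using gisoI[OF Lunit_globular Lunit_iso] by simp

lemma giso_Runit: "M \<in> Obj (D1 D) \<Longrightarrow> \<exists>\<beta>. giso (Runit D M) (M \<otimes> U (S M)) M \<beta>"
  using gisoI[OF Runit_globular Runit_iso] by simp

lemma giso_Assoc:
  assumes "M \<in> Obj (D1 D)" "N \<in> Obj (D1 D)" "P \<in> Obj (D1 D)" "S M = T N" "S N = T P"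
  shows "\<exists>\<beta>. giso (Assoc D M N P) ((M \<otimes> N) \<otimes> P) (M \<otimes> N \<otimes> P) \<beta>"
  using gisoI[OF Assoc_globular Assoc_iso] assms by simp

section \<open>Factorization through Cartesian cells\<close>

lemma cartesian_ex1:
  assumes "is_cartesian D \<alpha> M N f g" "cell \<beta> M' N (f \<Zsemi> h) (g \<Zsemi> k)"
    "h \<in> hom (D0 D) A (S M)" "k \<in> hom (D0 D) B (T M)"
  shows "\<exists>!\<gamma>. cell \<gamma> M' M h k \<and> \<alpha> \<bullet> \<gamma> = \<beta>"
proof -
  have "cell \<alpha> M N f g" using assms by (simp add: is_cartesian_def)
  from cell_Src[OF this] cell_Tgt[OF this]
  have "Dom (D0 D) f = S M" "Dom (D0 D) g = T M" by (auto simp: hom_def)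
  then have "h \<in> Arr (D0 D) \<and> k \<in> Arr (D0 D) \<and>
      Cod (D0 D) h = Dom (D0 D) f \<and> Cod (D0 D) k = Dom (D0 D) g \<and>
      cell \<beta> M' N (f \<Zsemi> h) (g \<Zsemi> k)"
    using assms by (simp add: hom_def)
  with assms(1) show ?thesis unfolding is_cartesian_def by simp
qed

lemma cartesian_factor:
  assumes "is_cartesian D \<alpha> M N f g" "cell \<beta> M' N (f \<Zsemi> h) (g \<Zsemi> k)"
    "h \<in> hom (D0 D) A (S M)" "k \<in> hom (D0 D) B (T M)"
  obtains \<gamma> where "cell \<gamma> M' M h k" "\<alpha> \<bullet> \<gamma> = \<beta>"
  using cartesian_ex1[OF assms] by blast

text \<open>Both cells factor \<open>\<alpha> \<bullet> \<gamma>\<close> over the same pair of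
  sides; a Cartesian cell need not be left cancellable across different sides.\<close>

lemma cartesian_unique:
  assumes "is_cartesian D \<alpha> M N f g" "cell \<gamma> M' M h k" "cell \<gamma>' M' M h k"
    "\<alpha> \<bullet> \<gamma> = \<alpha> \<bullet> \<gamma>'"
  shows "\<gamma> = \<gamma>'"
proof -
  have a: "cell \<alpha> M N f g" using assms by (simp add: is_cartesian_def)
  have "cell (\<alpha> \<bullet> \<gamma>) M' N (f \<Zsemi> h) (g \<Zsemi> k)"
    using cell_comp[OF assms(2) a] by simp
  from cartesian_ex1[OF assms(1) this cell_Src[OF assms(2)] cell_Tgt[OF assms(2)]]
  show ?thesis using assms(2,3) assms(4)[symmetric] by blast
qed

section \<open>Unit-purity and cells between units\<close>

text \<open>Fullness of \<open>U\<close> makes \<open>\<alpha>\<close> the image of an arrow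
  \<open>h\<close>, and S U = T U = id then identifies both sides of \<open>\<alpha>\<close> with
  \<open>h\<close>. The second conclusion is what later yields the commutativity of squares.\<close>

lemma cell_between_units:
  assumes "unit_pure D" "A \<in> Obj (D0 D)" "cell \<alpha> (U A) (U B) f g" "B \<in> Obj (D0 D)"
  shows "\<alpha> = U\<^sub>1 f" "f = g"
proof -
  have "\<alpha> \<in> hom (D1 D) (U A) (U B)" using assms(3) by (rule cell_hom)
  then obtain h where h: "h \<in> hom (D0 D) A B" "U\<^sub>1 h = \<alpha>"
    using assms(1,2,4) unfolding unit_pure_def full_functor_def by blast
  have "cell \<alpha> (U A) (U B) h h" using cell_Unit[OF h(1)] h(2) by simp
  then have "f = h" "g = h"
    using assms(3) unfolding is_cell_def by blast+
  with h show "\<alpha> = U\<^sub>1 f" "f = g" by auto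
qed

text \<open>Kelly's coherence lemma; unit-purity makes it immediate, because it leaves no nontrivial
  globular endomorphism of a unit.\<close>

lemma Lunit_Unit:
  assumes "unit_pure D" "A \<in> Obj (D0 D)"
  shows "Lunit D (U A) = Runit D (U A)"
proof -
  note o = Unit_Obj[OF assms(2)] and st = Src_Unit_ob[OF assms(2)] Tgt_Unit_ob[OF assms(2)]
  obtain l where l: "giso (Lunit D (U A)) (U A \<otimes> U A) (U A) l"
    using giso_Lunit[OF o] st by auto
  obtain r where r: "giso (Runit D (U A)) (U A \<otimes> U A) (U A) r"
    using giso_Runit[OF o] st by auto
  note lc = giso_cell[OF l] and rc = giso_cell[OF r]
  have e: "cell (Runit D (U A) \<bullet> l) (U A) (U A) (\<one> A) (\<one> A)"
    using giso_cell(1)[OF giso_comp[OF giso_sym[OF l] r]] st by simp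
  have "Runit D (U A) \<bullet> l = \<one>\<^sub>1 (U A)"
    using cell_between_units(1)[OF assms e assms(2)] Unit_vid[OF assms(2)] by simp
  then have "(Runit D (U A) \<bullet> l) \<bullet> Lunit D (U A) = Lunit D (U A)"
    using cell_comp_cid(2)[OF lc(1)] by simp
  moreover have "(Runit D (U A) \<bullet> l) \<bullet> Lunit D (U A) = Runit D (U A)"
    using cell_assoc[OF lc(1,2) rc(1)] lc cell_comp_cid(1)[OF rc(1)] by simp
  ultimately show ?thesis by simp
qed

section \<open>Units of companions and conjoints\<close>

text \<open>The Cartesian cell \<open>\<phi>\<close> is the counit of the companion. One companion
  identity defines the unit \<open>\<eta>\<close>; the other one can be checked after composing with
  \<open>\<phi>\<close>. It presents \<open>\<phi> \<odot> \<eta>\<close> as a composite of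
  invertible unitors, and this invertibility is what the uniqueness proofs below cancel.\<close>

lemma companion_unit:
  assumes "unit_pure D" "f \<in> hom (D0 D) A B"
    "is_cartesian D \<phi> M (U B) f (\<one> B)"
  obtains \<eta> i where "cell \<eta> (U A) M (\<one> A) f" "\<phi> \<bullet> \<eta> = U\<^sub>1 f" "S M = A" "T M = B"
    "giso (\<phi> \<odot> \<eta>) (M \<otimes> U A) (U B \<otimes> M) i" "Lunit D M \<bullet> (\<phi> \<odot> \<eta>) = Runit D M"
proof -
  have AB: "A \<in> Obj (D0 D)" "B \<in> Obj (D0 D)"
    using assms(2) V.Dom_Obj V.Cod_Obj by (auto simp: hom_def)
  note st = Src_Unit_ob[OF AB(1)] Tgt_Unit_ob[OF AB(1)] Src_Unit_ob[OF AB(2)] Tgt_Unit_ob[OF AB(2)]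
  have p: "cell \<phi> M (U B) f (\<one> B)" using assms(3) by (simp add: is_cartesian_def)
  note M = cell_Obj(1)[OF p]
  have SM: "S M = A" "T M = B"
    using cell_Src[OF p] cell_Tgt[OF p] assms(2) V.Id_hom[OF AB(2)] by (auto simp: hom_def)
  note id = comp_vid[OF assms(2)] comp_vid[OF V.Id_hom[OF AB(1)]] comp_vid[OF V.Id_hom[OF AB(2)]]
  note u = cell_Unit[OF assms(2)]
  \<comment> \<open>\<open>U\<^sub>1 f\<close> has sides \<open>f \<Zsemi> \<one> A\<close> and
    \<open>\<one> B \<Zsemi> f\<close>, so it factors through \<open>\<phi>\<close>.\<close>
  obtain \<eta> where e: "cell \<eta> (U A) M (\<one> A) f" "\<phi> \<bullet> \<eta> = U\<^sub>1 f"
    using cartesian_factor[OF assms(3), of "U\<^sub>1 f" "U A" "\<one> A" f A A] u id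
      V.Id_hom[OF AB(1)] assms(2) SM by auto
  obtain l where l: "giso (Lunit D M) (U B \<otimes> M) M l" using giso_Lunit[OF M] SM by auto
  obtain r where r: "giso (Runit D M) (M \<otimes> U A) M r" using giso_Runit[OF M] SM by auto
  note lc = giso_cell[OF l] and rc = giso_cell[OF r]
  have ends: "S (M \<otimes> U A) = A" "T (M \<otimes> U A) = B" "S (U B \<otimes> M) = A" "T (U B \<otimes> M) = B"
    using lc rc SM by auto
  have pe: "cell (\<phi> \<odot> \<eta>) (M \<otimes> U A) (U B \<otimes> M) (\<one> A) (\<one> B)"
    using cell_hcomp[OF p e(1)] .
  have lpe: "cell (Lunit D M \<bullet> (\<phi> \<odot> \<eta>)) (M \<otimes> U A) M (\<one> A) (\<one> B)"
    using cell_comp[OF pe lc(1)] ends id by simp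
  have up: "cell (U\<^sub>1 (\<one> B) \<odot> \<phi>) (U B \<otimes> M) (U B \<otimes> U B) f (\<one> B)"
    by (rule cell_hcomp[OF cell_Unit[OF V.Id_hom[OF AB(2)]] p])
  \<comment> \<open>Naturality moves \<open>\<phi>\<close> across the left unitor, interchange
    merges \<open>\<phi> \<bullet> \<eta>\<close> into \<open>U\<^sub>1 f\<close>, and the right
    unitor moves \<open>\<phi>\<close> back out. The change of unitor is possible because the two
    agree at \<open>U B\<close>.\<close>
  have "\<phi> \<bullet> (Lunit D M \<bullet> (\<phi> \<odot> \<eta>)) = (\<phi> \<bullet> Lunit D M) \<bullet> (\<phi> \<odot> \<eta>)"
    using cell_assoc[OF pe lc(1) p] by simp
  also have "\<dots> = (Lunit D (U B) \<bullet> (U\<^sub>1 (\<one> B) \<odot> \<phi>)) \<bullet> (\<phi> \<odot> \<eta>)"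
    using Lunit_nat[OF p] by simp
  also have "\<dots> = Lunit D (U B) \<bullet> ((U\<^sub>1 (\<one> B) \<odot> \<phi>) \<bullet> (\<phi> \<odot> \<eta>))"
    using cell_assoc[OF pe up] Lunit_globular[OF Unit_Obj[OF AB(2)]] st
    by (simp add: is_globular_def)
  also have "(U\<^sub>1 (\<one> B) \<odot> \<phi>) \<bullet> (\<phi> \<odot> \<eta>) = \<phi> \<odot> U\<^sub>1 f"
    using interchange[OF p e(1) cell_Unit[OF V.Id_hom[OF AB(2)]] p] e(2)
      cell_comp_cid(2)[OF p] Unit_vid[OF AB(2)] by simp
  also have "Lunit D (U B) \<bullet> (\<phi> \<odot> U\<^sub>1 f) = \<phi> \<bullet> Runit D M"
    using Runit_nat[OF p] Lunit_Unit[OF assms(1) AB(2)] by simp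
  finally have "Lunit D M \<bullet> (\<phi> \<odot> \<eta>) = Runit D M"
    using cartesian_unique[OF assms(3) lpe] rc(1) ends by simp
  moreover from this have "l \<bullet> Runit D M = (l \<bullet> Lunit D M) \<bullet> (\<phi> \<odot> \<eta>)"
    using cell_assoc[OF pe lc(1,2)] by simp
  then have "\<phi> \<odot> \<eta> = l \<bullet> Runit D M"
    using lc cell_comp_cid(2)[OF pe] by simp
  then have "giso (\<phi> \<odot> \<eta>) (M \<otimes> U A) (U B \<otimes> M) (r \<bullet> Lunit D M)"
    using giso_comp[OF r giso_sym[OF l]] by simp
  ultimately show thesis using that e SM by blast
qed

text \<open>The horizontal mirror image of \<open>companion_unit\<close>: source and target, and the
  left and right unitors, exchange their roles.\<close>

lemma conjoint_unit:
  assumes "unit_pure D" "g \<in> hom (D0 D) A B"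
    "is_cartesian D \<gamma> M (U B) (\<one> B) g"
  obtains \<eta> i where "cell \<eta> (U A) M g (\<one> A)" "\<gamma> \<bullet> \<eta> = U\<^sub>1 g" "S M = B" "T M = A"
    "giso (\<eta> \<odot> \<gamma>) (U A \<otimes> M) (M \<otimes> U B) i" "Runit D M \<bullet> (\<eta> \<odot> \<gamma>) = Lunit D M"
proof -
  have AB: "A \<in> Obj (D0 D)" "B \<in> Obj (D0 D)"
    using assms(2) V.Dom_Obj V.Cod_Obj by (auto simp: hom_def)
  note st = Src_Unit_ob[OF AB(1)] Tgt_Unit_ob[OF AB(1)] Src_Unit_ob[OF AB(2)] Tgt_Unit_ob[OF AB(2)]
  have p: "cell \<gamma> M (U B) (\<one> B) g" using assms(3) by (simp add: is_cartesian_def)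
  note M = cell_Obj(1)[OF p]
  have SM: "S M = B" "T M = A"
    using cell_Src[OF p] cell_Tgt[OF p] assms(2) V.Id_hom[OF AB(2)] by (auto simp: hom_def)
  note id = comp_vid[OF assms(2)] comp_vid[OF V.Id_hom[OF AB(1)]] comp_vid[OF V.Id_hom[OF AB(2)]]
  note u = cell_Unit[OF assms(2)]
  obtain \<eta> where e: "cell \<eta> (U A) M g (\<one> A)" "\<gamma> \<bullet> \<eta> = U\<^sub>1 g"
    using cartesian_factor[OF assms(3), of "U\<^sub>1 g" "U A" g "\<one> A" A A] u id
      V.Id_hom[OF AB(1)] assms(2) SM by auto
  obtain l where l: "giso (Lunit D M) (U A \<otimes> M) M l" using giso_Lunit[OF M] SM by auto
  obtain r where r: "giso (Runit D M) (M \<otimes> U B) M r" using giso_Runit[OF M] SM by auto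
  note lc = giso_cell[OF l] and rc = giso_cell[OF r]
  have ends: "S (M \<otimes> U B) = B" "T (M \<otimes> U B) = A" "S (U A \<otimes> M) = B" "T (U A \<otimes> M) = A"
    using lc rc SM by auto
  have pe: "cell (\<eta> \<odot> \<gamma>) (U A \<otimes> M) (M \<otimes> U B) (\<one> B) (\<one> A)"
    using cell_hcomp[OF e(1) p] .
  have rpe: "cell (Runit D M \<bullet> (\<eta> \<odot> \<gamma>)) (U A \<otimes> M) M (\<one> B) (\<one> A)"
    using cell_comp[OF pe rc(1)] ends id by simp
  have up: "cell (\<gamma> \<odot> U\<^sub>1 (\<one> B)) (M \<otimes> U B) (U B \<otimes> U B) (\<one> B) g"
    by (rule cell_hcomp[OF p cell_Unit[OF V.Id_hom[OF AB(2)]]])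
  have "\<gamma> \<bullet> (Runit D M \<bullet> (\<eta> \<odot> \<gamma>)) = (\<gamma> \<bullet> Runit D M) \<bullet> (\<eta> \<odot> \<gamma>)"
    using cell_assoc[OF pe rc(1) p] by simp
  also have "\<dots> = (Runit D (U B) \<bullet> (\<gamma> \<odot> U\<^sub>1 (\<one> B))) \<bullet> (\<eta> \<odot> \<gamma>)"
    using Runit_nat[OF p] by simp
  also have "\<dots> = Runit D (U B) \<bullet> ((\<gamma> \<odot> U\<^sub>1 (\<one> B)) \<bullet> (\<eta> \<odot> \<gamma>))"
    using cell_assoc[OF pe up] Runit_globular[OF Unit_Obj[OF AB(2)]] st
    by (simp add: is_globular_def)
  also have "(\<gamma> \<odot> U\<^sub>1 (\<one> B)) \<bullet> (\<eta> \<odot> \<gamma>) = U\<^sub>1 g \<odot> \<gamma>"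
    using interchange[OF e(1) p p cell_Unit[OF V.Id_hom[OF AB(2)]]] e(2)
      cell_comp_cid(2)[OF p] Unit_vid[OF AB(2)] by simp
  also have "Runit D (U B) \<bullet> (U\<^sub>1 g \<odot> \<gamma>) = \<gamma> \<bullet> Lunit D M"
    using Lunit_nat[OF p] Lunit_Unit[OF assms(1) AB(2)] by simp
  finally have "Runit D M \<bullet> (\<eta> \<odot> \<gamma>) = Lunit D M"
    using cartesian_unique[OF assms(3) rpe] lc(1) ends by simp
  moreover from this have "r \<bullet> Lunit D M = (r \<bullet> Runit D M) \<bullet> (\<eta> \<odot> \<gamma>)"
    using cell_assoc[OF pe rc(1,2)] by simp
  then have "\<eta> \<odot> \<gamma> = r \<bullet> Lunit D M"
    using rc cell_comp_cid(2)[OF pe] by simp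
  then have "giso (\<eta> \<odot> \<gamma>) (U A \<otimes> M) (M \<otimes> U B) (l \<bullet> Runit D M)"
    using giso_comp[OF l giso_sym[OF r]] by simp
  ultimately show thesis using that e SM by blast
qed

section \<open>Rules for invertibility, faithfulness and universal properties\<close>

text \<open>Two out of three; together with the next lemma it transports invertibility along an
  associator.\<close>

lemma giso_left_factor:
  assumes "giso \<alpha> M N \<alpha>'" "giso (\<beta> \<bullet> \<alpha>) M P \<delta>" "cell \<beta> N P f g"
  shows "giso \<beta> N P (\<alpha> \<bullet> \<delta>)"
  using giso_comp[OF giso_sym[OF assms(1)] assms(2)] giso_cancel_right[OF assms(1,3)] by simp

lemma giso_right_factor:
  assumes "giso \<beta> N P \<beta>'" "giso (\<beta> \<bullet> \<alpha>) M P \<delta>" "cell \<alpha> M N f g"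
  shows "giso \<alpha> M N (\<delta> \<bullet> \<beta>)"
  using giso_comp[OF assms(2) giso_sym[OF assms(1)]] giso_cancel[OF assms(1,3)] by simp

lemma cell_Lunit:
  "M \<in> Obj (D1 D) \<Longrightarrow> cell (Lunit D M) (U (T M) \<otimes> M) M (\<one> (S M)) (\<one> (T M))"
  using Lunit_globular globular_ends[OF Lunit_globular] by (simp add: is_globular_def)

lemma cell_Runit:
  "M \<in> Obj (D1 D) \<Longrightarrow> cell (Runit D M) (M \<otimes> U (S M)) M (\<one> (S M)) (\<one> (T M))"
  using Runit_globular globular_ends[OF Runit_globular] by (simp add: is_globular_def)

text \<open>Naturality of the unitor turns composition with a unit cell into vertical composition
  with an invertible cell, which can be cancelled.\<close>

lemma Lunit_faithful:
  assumes "cell \<alpha> M N f g" "cell \<beta> M N h g" "U\<^sub>1 g \<odot> \<alpha> = U\<^sub>1 g \<odot> \<beta>"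
  shows "\<alpha> = \<beta>"
proof -
  have "\<alpha> \<bullet> Lunit D M = \<beta> \<bullet> Lunit D M"
    unfolding Lunit_nat[OF assms(1), symmetric] Lunit_nat[OF assms(2), symmetric] assms(3) ..
  then show ?thesis
    using giso_Lunit[OF cell_Obj(1)[OF assms(1)]] giso_epi assms(1,2) by blast
qed

lemma Runit_faithful:
  assumes "cell \<alpha> M N f g" "cell \<beta> M N f h" "\<alpha> \<odot> U\<^sub>1 f = \<beta> \<odot> U\<^sub>1 f"
  shows "\<alpha> = \<beta>"
proof -
  have "\<alpha> \<bullet> Runit D M = \<beta> \<bullet> Runit D M"
    unfolding Runit_nat[OF assms(1), symmetric] Runit_nat[OF assms(2), symmetric] assms(3) ..
  then show ?thesis
    using giso_Runit[OF cell_Obj(1)[OF assms(1)]] giso_epi assms(1,2) by blast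
qed

text \<open>The definition leaves the domains of \<open>h\<close> and \<open>k\<close> open; the
  sides of \<open>\<beta>\<close> force them to be the source and target of \<open>M'\<close>, so
  existence has to be proved only for such arrows.\<close>

lemma cartesianI:
  assumes c: "cell \<alpha> M N f g"
    and ex: "\<And>M' h k \<beta>. \<lbrakk>h \<in> hom (D0 D) (S M') (S M); k \<in> hom (D0 D) (T M') (T M);
      cell \<beta> M' N (f \<Zsemi> h) (g \<Zsemi> k)\<rbrakk> \<Longrightarrow> \<exists>\<gamma>. cell \<gamma> M' M h k \<and> \<alpha> \<bullet> \<gamma> = \<beta>"
    and un: "\<And>M' h k \<gamma> \<gamma>'. \<lbrakk>cell \<gamma> M' M h k; cell \<gamma>' M' M h k; \<alpha> \<bullet> \<gamma> = \<alpha> \<bullet> \<gamma>'\<rbrakk> \<Longrightarrow> \<gamma> = \<gamma>'"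
  shows "is_cartesian D \<alpha> M N f g"
  unfolding is_cartesian_def
proof (intro conjI allI impI c)
  fix M' h k \<beta>
  assume *: "h \<in> Arr (D0 D) \<and> k \<in> Arr (D0 D) \<and>
      Cod (D0 D) h = Dom (D0 D) f \<and> Cod (D0 D) k = Dom (D0 D) g \<and>
      cell \<beta> M' N (f \<Zsemi> h) (g \<Zsemi> k)"
  then have b: "cell \<beta> M' N (f \<Zsemi> h) (g \<Zsemi> k)" by simp
  have h: "h \<in> hom (D0 D) (Dom (D0 D) h) (S M)" and k: "k \<in> hom (D0 D) (Dom (D0 D) k) (T M)"
    using * cell_Src[OF c] cell_Tgt[OF c] by (auto simp: hom_def)
  have "Dom (D0 D) h = S M'" "Dom (D0 D) k = T M'"
    using V.Comp_hom[OF h cell_Src[OF c]] V.Comp_hom[OF k cell_Tgt[OF c]]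
      cell_Src[OF b] cell_Tgt[OF b] by (auto simp: hom_def)
  then have "\<exists>\<gamma>. cell \<gamma> M' M h k \<and> \<alpha> \<bullet> \<gamma> = \<beta>" using ex[OF _ _ b] h k by simp
  then show "\<exists>!\<gamma>. cell \<gamma> M' M h k \<and> \<alpha> \<bullet> \<gamma> = \<beta>" using un by blast
qed

text \<open>Dual to \<open>cartesianI\<close>: here the sides of \<open>\<beta>\<close> determine
  the codomains of \<open>h\<close> and \<open>k\<close>.\<close>

lemma op_cartesianI:
  assumes c: "cell \<alpha> M N f g"
    and ex: "\<And>N' h k \<beta>. \<lbrakk>h \<in> hom (D0 D) (S N) (S N'); k \<in> hom (D0 D) (T N) (T N');
      cell \<beta> M N' (h \<Zsemi> f) (k \<Zsemi> g)\<rbrakk> \<Longrightarrow> \<exists>\<gamma>. cell \<gamma> N N' h k \<and> \<gamma> \<bullet> \<alpha> = \<beta>"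
    and un: "\<And>N' h k \<gamma> \<gamma>'. \<lbrakk>cell \<gamma> N N' h k; cell \<gamma>' N N' h k; \<gamma> \<bullet> \<alpha> = \<gamma>' \<bullet> \<alpha>\<rbrakk> \<Longrightarrow> \<gamma> = \<gamma>'"
  shows "is_op_cartesian D \<alpha> M N f g"
  unfolding is_op_cartesian_def
proof (intro conjI allI impI c)
  fix N' h k \<beta>
  assume *: "h \<in> Arr (D0 D) \<and> k \<in> Arr (D0 D) \<and>
      Dom (D0 D) h = Cod (D0 D) f \<and> Dom (D0 D) k = Cod (D0 D) g \<and>
      cell \<beta> M N' (h \<Zsemi> f) (k \<Zsemi> g)"
  then have b: "cell \<beta> M N' (h \<Zsemi> f) (k \<Zsemi> g)" by simp
  have h: "h \<in> hom (D0 D) (S N) (Cod (D0 D) h)" and k: "k \<in> hom (D0 D) (T N) (Cod (D0 D) k)"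
    using * cell_Src[OF c] cell_Tgt[OF c] by (auto simp: hom_def)
  have "Cod (D0 D) h = S N'" "Cod (D0 D) k = T N'"
    using V.Comp_hom[OF cell_Src[OF c] h] V.Comp_hom[OF cell_Tgt[OF c] k]
      cell_Src[OF b] cell_Tgt[OF b] by (auto simp: hom_def)
  then have "\<exists>\<gamma>. cell \<gamma> N N' h k \<and> \<gamma> \<bullet> \<alpha> = \<beta>" using ex[OF _ _ b] h k by simp
  then show "\<exists>!\<gamma>. cell \<gamma> N N' h k \<and> \<gamma> \<bullet> \<alpha> = \<beta>" using un by blast
qed

section \<open>Universal cells of composites of companions and conjoints\<close>

text \<open>The Cartesian cell is the horizontal composite of the two counits, followed by a unitor.
  Factorizations are built with the unit of the conjoint; they are unique because
  \<open>\<phi>\<close> is Cartesian and \<open>\<eta> \<odot> \<gamma>\<close> is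
  invertible.\<close>

lemma ex_cartesian_conjoint_companion:
  assumes up: "unit_pure D" and f: "f \<in> hom (D0 D) A C" and g: "g \<in> hom (D0 D) B C"
    and Mg: "is_conjoint D g M" and Nf: "is_companion D f N"
  shows "\<exists>c. is_cartesian D c (M \<otimes> N) (U C) f g"
proof -
  have ABC: "A \<in> Obj (D0 D)" "B \<in> Obj (D0 D)" "C \<in> Obj (D0 D)"
    using f g V.Dom_Obj V.Cod_Obj by (auto simp: hom_def)
  note i = V.Id_hom[OF ABC(1)] V.Id_hom[OF ABC(2)] V.Id_hom[OF ABC(3)]
  note st = Src_Unit_ob[OF ABC(3)] Tgt_Unit_ob[OF ABC(3)]
  note id = comp_vid[OF f] comp_vid[OF g] comp_vid[OF i(1)] comp_vid[OF i(2)] comp_vid[OF i(3)]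
  obtain \<gamma> where \<gamma>: "is_cartesian D \<gamma> M (U C) (\<one> C) g"
    using Mg g by (auto simp: is_conjoint_def hom_def)
  obtain \<phi> where \<phi>: "is_cartesian D \<phi> N (U C) f (\<one> C)"
    using Nf f by (auto simp: is_companion_def hom_def)
  obtain \<eta> j where e: "cell \<eta> (U B) M g (\<one> B)" "\<gamma> \<bullet> \<eta> = U\<^sub>1 g" and M: "S M = C" "T M = B"
    and eg: "giso (\<eta> \<odot> \<gamma>) (U B \<otimes> M) (M \<otimes> U C) j"
    by (rule conjoint_unit[OF up g \<gamma>])
  have N: "S N = A" "T N = C" by (rule companion_unit[OF up f \<phi>], simp)+
  have gc: "cell \<gamma> M (U C) (\<one> C) g" using \<gamma> by (simp add: is_cartesian_def)
  have pc: "cell \<phi> N (U C) f (\<one> C)" using \<phi> by (simp add: is_cartesian_def)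
  note o = cell_Obj(1)[OF gc] cell_Obj(1)[OF pc] cell_Obj(2)[OF gc]
  have W: "M \<otimes> N \<in> Obj (D1 D)" "S (M \<otimes> N) = A" "T (M \<otimes> N) = B"
    using hcomp_Obj Src_Hcomp_ob Tgt_Hcomp_ob o M N by auto
  have L: "cell (Lunit D (U C)) (U C \<otimes> U C) (U C) (\<one> C) (\<one> C)"
    using cell_Lunit[OF o(3)] st by simp
  note gp = cell_hcomp[OF gc pc]
  define c where "c = Lunit D (U C) \<bullet> (\<gamma> \<odot> \<phi>)"
  have c: "cell c (M \<otimes> N) (U C) f g"
    unfolding c_def by (rule cell_comp[OF gp L]) (simp_all add: id)
  have "is_cartesian D c (M \<otimes> N) (U C) f g"
  proof (rule cartesianI[OF c])
    fix M' h k \<beta>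
    assume h: "h \<in> hom (D0 D) (S M') (S (M \<otimes> N))" and k: "k \<in> hom (D0 D) (T M') (T (M \<otimes> N))"
      and b: "cell \<beta> M' (U C) (f \<Zsemi> h) (g \<Zsemi> k)"
    note h = h[unfolded W] and k = k[unfolded W]
    note M' = cell_Obj(1)[OF b]
    have gk: "g \<Zsemi> k \<in> hom (D0 D) (T M') C" by (rule V.Comp_hom[OF k g])
    \<comment> \<open>Factoring through \<open>\<phi>\<close> takes care of the source side only;
      the target side is still \<open>g \<Zsemi> k\<close>.\<close>
    obtain \<beta>' where b': "cell \<beta>' M' N h (g \<Zsemi> k)" "\<phi> \<bullet> \<beta>' = \<beta>"
      using cartesian_factor[OF \<phi>, of \<beta> M' h "g \<Zsemi> k" "S M'" "T M'"] b comp_vid[OF gk] gk h N by auto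
    obtain l where l: "giso (Lunit D M') (U (T M') \<otimes> M') M' l" using giso_Lunit[OF M'] by blast
    have ek: "cell (\<eta> \<bullet> U\<^sub>1 k) (U (T M')) M (g \<Zsemi> k) k"
      by (rule cell_comp[OF cell_Unit[OF k] e(1)]) (simp_all add: comp_vid[OF k])
    \<comment> \<open>The unit \<open>\<eta>\<close> removes \<open>g\<close> from the target side,
      and \<open>\<gamma> \<bullet> \<eta> = U\<^sub>1 g\<close> puts it back when \<open>c\<close>
      is applied.\<close>
    define \<delta> where "\<delta> = (\<eta> \<bullet> U\<^sub>1 k) \<odot> \<beta>'"
    have d: "cell \<delta> (U (T M') \<otimes> M') (M \<otimes> N) h k"
      unfolding \<delta>_def by (rule cell_hcomp[OF ek b'(1)])
    have lc: "cell l M' (U (T M') \<otimes> M') (\<one> (S M')) (\<one> (T M'))"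
      using giso_cell(2,5,6)[OF l] by simp
    have dl: "cell (\<delta> \<bullet> l) M' (M \<otimes> N) h k"
      by (rule cell_comp[OF lc d]) (simp_all add: comp_vid[OF h] comp_vid[OF k])
    have "\<gamma> \<bullet> (\<eta> \<bullet> U\<^sub>1 k) = U\<^sub>1 (g \<Zsemi> k)"
      using cell_assoc[OF cell_Unit[OF k] e(1) gc] e(2) Unit_comp[OF k g] by simp
    then have "(\<gamma> \<odot> \<phi>) \<bullet> \<delta> = U\<^sub>1 (g \<Zsemi> k) \<odot> \<beta>"
      unfolding \<delta>_def interchange[OF ek b'(1) gc pc] b'(2) by simp
    then have "c \<bullet> \<delta> = \<beta> \<bullet> Lunit D M'"
      unfolding c_def cell_assoc[OF d gp L] using Lunit_nat[OF b] by simp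
    then have "c \<bullet> (\<delta> \<bullet> l) = \<beta>"
      using cell_assoc[OF lc d c] giso_cancel_right[OF l b] by simp
    with dl show "\<exists>\<gamma>. cell \<gamma> M' (M \<otimes> N) h k \<and> c \<bullet> \<gamma> = \<beta>" by blast
  next
    fix M' h k \<delta> \<delta>'
    assume d: "cell \<delta> M' (M \<otimes> N) h k" and d': "cell \<delta>' M' (M \<otimes> N) h k"
      and eq: "c \<bullet> \<delta> = c \<bullet> \<delta>'"
    note k = cell_Tgt[OF d, unfolded W]
    have n: "cell (\<one>\<^sub>1 N) N N (\<one> A) (\<one> C)" using cell_cid[OF o(2)] N by simp
    \<comment> \<open>Applying the counits one after the other gives
      \<open>c = \<phi> \<bullet> (Lunit D N \<bullet> G)\<close>. Then \<open>\<phi>\<close>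
      cancels as a Cartesian cell and the unitor as an invertible one, which leaves
      \<open>G\<close>.\<close>
    define G where "G = \<gamma> \<odot> \<one>\<^sub>1 N"
    have G: "cell G (M \<otimes> N) (U C \<otimes> N) (\<one> A) g" unfolding G_def by (rule cell_hcomp[OF gc n])
    obtain l where l: "giso (Lunit D N) (U C \<otimes> N) N l" using giso_Lunit[OF o(2)] N by auto
    have ln: "cell (Lunit D N) (U C \<otimes> N) N (\<one> A) (\<one> C)" using cell_Lunit[OF o(2)] N by simp
    have lg: "cell (Lunit D N \<bullet> G) (M \<otimes> N) N (\<one> A) g"
      by (rule cell_comp[OF G ln]) (simp_all add: id)
    note uc = cell_Unit[OF i(3)]
    have "\<phi> \<bullet> (Lunit D N \<bullet> G) = (\<phi> \<bullet> Lunit D N) \<bullet> G"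
      by (rule cell_assoc[OF G ln pc, symmetric])
    also have "\<dots> = (Lunit D (U C) \<bullet> (U\<^sub>1 (\<one> C) \<odot> \<phi>)) \<bullet> G"
      using Lunit_nat[OF pc] by simp
    also have "\<dots> = Lunit D (U C) \<bullet> ((U\<^sub>1 (\<one> C) \<odot> \<phi>) \<bullet> G)"
      by (rule cell_assoc[OF G cell_hcomp[OF uc pc] L])
    also have "(U\<^sub>1 (\<one> C) \<odot> \<phi>) \<bullet> G = \<gamma> \<odot> \<phi>"
      unfolding G_def interchange[OF gc n uc pc]
      using Unit_vid[OF ABC(3)] cell_comp_cid(2)[OF gc] cell_comp_cid(1)[OF pc] by simp
    finally have c': "c = \<phi> \<bullet> (Lunit D N \<bullet> G)" by (simp add: c_def)
    have "(Lunit D N \<bullet> G) \<bullet> \<delta> = (Lunit D N \<bullet> G) \<bullet> \<delta>'"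
      using eq unfolding c' cell_assoc[OF d lg pc] cell_assoc[OF d' lg pc]
      by (rule cartesian_unique[OF \<phi> cell_comp[OF d lg refl refl] cell_comp[OF d' lg refl refl]])
    then have Gd: "G \<bullet> \<delta> = G \<bullet> \<delta>'"
      unfolding cell_assoc[OF d G ln] cell_assoc[OF d' G ln]
      by (rule giso_mono[OF l cell_comp[OF d G refl refl] cell_comp[OF d' G refl refl]])
    have ends: "S (U B) = T M" "S M = T N" "T (U C) = S M" "S (U C) = T N"
      using M N st Src_Unit_ob[OF ABC(2)] by auto
    obtain a where a: "giso (Assoc D (U B) M N) ((U B \<otimes> M) \<otimes> N) (U B \<otimes> M \<otimes> N) a"
      using giso_Assoc[OF Unit_Obj[OF ABC(2)] o(1,2)] ends by blast
    obtain a' where a': "giso (Assoc D M (U C) N) ((M \<otimes> U C) \<otimes> N) (M \<otimes> U C \<otimes> N) a'"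
      using giso_Assoc[OF o(1,3,2)] ends by auto
    \<comment> \<open>Nothing says that \<open>G\<close> is invertible, but
      \<open>\<eta> \<odot> G\<close> is: up to associators it is
      \<open>(\<eta> \<odot> \<gamma>) \<odot> \<one>\<^sub>1 N\<close>.\<close>
    have X: "giso ((\<eta> \<odot> \<gamma>) \<odot> \<one>\<^sub>1 N) ((U B \<otimes> M) \<otimes> N) ((M \<otimes> U C) \<otimes> N) (j \<odot> \<one>\<^sub>1 N)"
      using giso_hcomp[OF eg giso_cid[OF o(2)]] Src_Hcomp_ob[OF Unit_Obj[OF ABC(2)] o(1)] ends by simp
    have eG: "cell (\<eta> \<odot> G) (U B \<otimes> M \<otimes> N) (M \<otimes> U C \<otimes> N) (\<one> A) (\<one> B)"
      by (rule cell_hcomp[OF e(1) G])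
    have "giso ((\<eta> \<odot> G) \<bullet> Assoc D (U B) M N) ((U B \<otimes> M) \<otimes> N) (M \<otimes> U C \<otimes> N) ((j \<odot> \<one>\<^sub>1 N) \<bullet> a')"
      using giso_comp[OF X a'] Assoc_nat[OF e(1) gc n] by (simp add: G_def)
    note iso = giso_left_factor[OF a this eG]
    note uk = cell_Unit[OF k]
    \<comment> \<open>By interchange the two sides involve \<open>\<delta>\<close> and
      \<open>\<delta>'\<close> only through \<open>G \<bullet> \<delta>\<close> and
      \<open>G \<bullet> \<delta>'\<close>, which are equal by \<open>Gd\<close>.\<close>
    have "(\<eta> \<odot> G) \<bullet> (U\<^sub>1 k \<odot> \<delta>) = (\<eta> \<odot> G) \<bullet> (U\<^sub>1 k \<odot> \<delta>')"
      unfolding interchange[OF uk d e(1) G] interchange[OF uk d' e(1) G] Gd by simp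
    then have "U\<^sub>1 k \<odot> \<delta> = U\<^sub>1 k \<odot> \<delta>'"
      by (rule giso_mono[OF iso cell_hcomp[OF uk d] cell_hcomp[OF uk d']])
    then show "\<delta> = \<delta>'" by (rule Lunit_faithful[OF d d'])
  qed
  then show ?thesis by blast
qed

text \<open>The op-Cartesian cell is the horizontal composite of the two units, preceded by an
  inverse unitor. The counits extend a cell along one unit after the other; uniqueness cancels the
  units in turn, each through its invertible composite with the counit.\<close>

lemma ex_op_cartesian_companion_conjoint:
  assumes up: "unit_pure D" and p: "p \<in> hom (D0 D) P A" and q: "q \<in> hom (D0 D) P B"
    and Mq: "is_companion D q M" and Np: "is_conjoint D p N"
  shows "\<exists>u. is_op_cartesian D u (U P) (M \<otimes> N) p q"
proof -
  have ABP: "A \<in> Obj (D0 D)" "B \<in> Obj (D0 D)" "P \<in> Obj (D0 D)"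
    using p q V.Dom_Obj V.Cod_Obj by (auto simp: hom_def)
  note i = V.Id_hom[OF ABP(1)] V.Id_hom[OF ABP(2)] V.Id_hom[OF ABP(3)]
  note st = Src_Unit_ob[OF ABP(3)] Tgt_Unit_ob[OF ABP(3)]
  note id = comp_vid[OF p] comp_vid[OF q] comp_vid[OF i(1)] comp_vid[OF i(2)] comp_vid[OF i(3)]
  obtain \<phi> where \<phi>: "is_cartesian D \<phi> M (U B) q (\<one> B)"
    using Mq q by (auto simp: is_companion_def hom_def)
  obtain \<gamma> where \<gamma>: "is_cartesian D \<gamma> N (U A) (\<one> A) p"
    using Np p by (auto simp: is_conjoint_def hom_def)
  obtain \<eta> j where e: "cell \<eta> (U P) M (\<one> P) q" "\<phi> \<bullet> \<eta> = U\<^sub>1 q" and M: "S M = P" "T M = B"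
    and pe: "giso (\<phi> \<odot> \<eta>) (M \<otimes> U P) (U B \<otimes> M) j"
    by (rule companion_unit[OF up q \<phi>])
  obtain \<epsilon> j' where d: "cell \<epsilon> (U P) N p (\<one> P)" "\<gamma> \<bullet> \<epsilon> = U\<^sub>1 p" and N: "S N = A" "T N = P"
    and dg: "giso (\<epsilon> \<odot> \<gamma>) (U P \<otimes> N) (N \<otimes> U A) j'"
    by (rule conjoint_unit[OF up p \<gamma>])
  have pc: "cell \<phi> M (U B) q (\<one> B)" using \<phi> by (simp add: is_cartesian_def)
  have gc: "cell \<gamma> N (U A) (\<one> A) p" using \<gamma> by (simp add: is_cartesian_def)
  note o = cell_Obj(1)[OF pc] cell_Obj(1)[OF gc] Unit_Obj[OF ABP(1)] Unit_Obj[OF ABP(2)]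
    Unit_Obj[OF ABP(3)]
  have V: "S (M \<otimes> N) = A" "T (M \<otimes> N) = B"
    using Src_Hcomp_ob Tgt_Hcomp_ob o M N by auto
  obtain l where l: "giso (Lunit D (U P)) (U P \<otimes> U P) (U P) l"
    using giso_Lunit[OF o(5)] st by auto
  have lc: "cell l (U P) (U P \<otimes> U P) (\<one> P) (\<one> P)"
    using giso_cell(2,5,6)[OF l] st by simp
  have LR: "Lunit D (U P) = Runit D (U P)" by (rule Lunit_Unit[OF up ABP(3)])
  note ed = cell_hcomp[OF e(1) d(1)]
  define u where "u = (\<eta> \<odot> \<epsilon>) \<bullet> l"
  have u: "cell u (U P) (M \<otimes> N) p q"
    unfolding u_def by (rule cell_comp[OF lc ed]) (simp_all add: id)
  have "is_op_cartesian D u (U P) (M \<otimes> N) p q"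
  proof (rule op_cartesianI[OF u])
    fix N' h k \<beta>
    assume h: "h \<in> hom (D0 D) (S (M \<otimes> N)) (S N')" and k: "k \<in> hom (D0 D) (T (M \<otimes> N)) (T N')"
      and b: "cell \<beta> (U P) N' (h \<Zsemi> p) (k \<Zsemi> q)"
    note h = h[unfolded V] and k = k[unfolded V]
    note N' = cell_Obj(2)[OF b]
    have hp: "h \<Zsemi> p \<in> hom (D0 D) P (S N')" by (rule V.Comp_hom[OF p h])
    have idk: "\<one> (T N') \<Zsemi> k = k" "k \<Zsemi> \<one> B = k" and idh: "\<one> (S N') \<Zsemi> h = h" "h \<Zsemi> \<one> A = h"
      and idhp: "\<one> (S N') \<Zsemi> (h \<Zsemi> p) = h \<Zsemi> p" "(h \<Zsemi> p) \<Zsemi> \<one> P = h \<Zsemi> p"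
      using comp_vid[OF h] comp_vid[OF k] comp_vid[OF hp] by auto
    note ln = cell_Lunit[OF N'] and rn = cell_Runit[OF N']
    note uk = cell_Unit[OF k] and uh = cell_Unit[OF h]
    have kp: "cell (U\<^sub>1 k \<bullet> \<phi>) M (U (T N')) (k \<Zsemi> q) k"
      by (rule cell_comp[OF pc uk]) (simp_all add: idk)
    have hg: "cell (U\<^sub>1 h \<bullet> \<gamma>) N (U (S N')) h (h \<Zsemi> p)"
      by (rule cell_comp[OF gc uh]) (simp_all add: idh)
    have kpe: "(U\<^sub>1 k \<bullet> \<phi>) \<bullet> \<eta> = U\<^sub>1 (k \<Zsemi> q)"
      unfolding cell_assoc[OF e(1) pc uk] e(2) by (rule Unit_comp[OF q k, symmetric])
    have hge: "(U\<^sub>1 h \<bullet> \<gamma>) \<bullet> \<epsilon> = U\<^sub>1 (h \<Zsemi> p)"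
      unfolding cell_assoc[OF d(1) gc uh] d(2) by (rule Unit_comp[OF p h, symmetric])
    note kpb = cell_hcomp[OF kp b]
    obtain r where r: "giso (Runit D M) (M \<otimes> U P) M r" using giso_Runit[OF o(1)] M by auto
    have rM: "cell (Runit D M) (M \<otimes> U P) M (\<one> P) (\<one> B)"
      using cell_Runit[OF o(1)] M by simp
    have rc: "cell r M (M \<otimes> U P) (\<one> P) (\<one> B)" using giso_cell(2,5,6)[OF r] M by simp
    have rP: "cell (Runit D (U P)) (U P \<otimes> U P) (U P) (\<one> P) (\<one> P)"
      using cell_Runit[OF o(5)] st by simp
    \<comment> \<open>First extension, along \<open>\<eta>\<close>: the counit \<open>\<phi>\<close>
      trades the target side \<open>k \<Zsemi> q\<close> of \<open>\<beta>\<close> for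
      \<open>k\<close>, and \<open>r\<close> then makes \<open>M\<close> the domain.\<close>
    define X where "X = Lunit D N' \<bullet> ((U\<^sub>1 k \<bullet> \<phi>) \<odot> \<beta>)"
    have X: "cell X (M \<otimes> U P) N' (h \<Zsemi> p) k"
      unfolding X_def by (rule cell_comp[OF kpb ln]) (simp_all add: idhp idk)
    have Xr: "cell (X \<bullet> r) M N' (h \<Zsemi> p) k"
      by (rule cell_comp[OF rc X]) (simp_all add: idhp idk)
    note uP = cell_Unit[OF i(3)]
    note eu = cell_hcomp[OF e(1) uP]
    \<comment> \<open>The equation \<open>(X \<bullet> r) \<bullet> \<eta> = \<beta>\<close> is
      checked after the invertible \<open>Runit D (U P)\<close>, where naturality moves
      \<open>\<eta>\<close> next to \<open>\<phi>\<close> and \<open>\<phi> \<bullet> \<eta>\<close>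
      becomes \<open>U\<^sub>1 q\<close>.\<close>
    have "((X \<bullet> r) \<bullet> \<eta>) \<bullet> Runit D (U P) = (X \<bullet> r) \<bullet> (Runit D M \<bullet> (\<eta> \<odot> U\<^sub>1 (\<one> P)))"
      unfolding cell_assoc[OF rP e(1) Xr] Runit_nat[OF e(1)] ..
    also have "\<dots> = X \<bullet> (\<eta> \<odot> U\<^sub>1 (\<one> P))"
      unfolding cell_assoc[OF cell_comp[OF eu rM refl refl] rc X] giso_cancel[OF r eu] ..
    also have "\<dots> = Lunit D N' \<bullet> (U\<^sub>1 (k \<Zsemi> q) \<odot> \<beta>)"
      unfolding X_def cell_assoc[OF eu kpb ln] interchange[OF e(1) uP kp b] kpe
      unfolding Unit_vid[OF ABP(3)] cell_comp_cid(1)[OF b] ..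
    also have "\<dots> = \<beta> \<bullet> Runit D (U P)"
      using Lunit_nat[OF b] unfolding LR .
    finally have Xe: "(X \<bullet> r) \<bullet> \<eta> = \<beta>"
      using giso_epi[OF l[unfolded LR] cell_comp[OF e(1) Xr refl refl] b] by blast
    \<comment> \<open>Second extension, along \<open>\<epsilon>\<close>: the counit
      \<open>\<gamma>\<close> trades the source side \<open>h \<Zsemi> p\<close> for
      \<open>h\<close>.\<close>
    define \<psi> where "\<psi> = Runit D N' \<bullet> ((X \<bullet> r) \<odot> (U\<^sub>1 h \<bullet> \<gamma>))"
    note Xg = cell_hcomp[OF Xr hg]
    have \<psi>: "cell \<psi> (M \<otimes> N) N' h k"
      unfolding \<psi>_def by (rule cell_comp[OF Xg rn]) (simp_all add: idh idk)
    have "\<psi> \<bullet> (\<eta> \<odot> \<epsilon>) = Runit D N' \<bullet> (\<beta> \<odot> U\<^sub>1 (h \<Zsemi> p))"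
      unfolding \<psi>_def cell_assoc[OF ed Xg rn] interchange[OF e(1) d(1) Xr hg] Xe hge ..
    also have "\<dots> = \<beta> \<bullet> Lunit D (U P)"
      using Runit_nat[OF b] unfolding LR .
    finally have "\<psi> \<bullet> u = (\<beta> \<bullet> Lunit D (U P)) \<bullet> l"
      unfolding u_def cell_assoc[OF lc ed \<psi>, symmetric] by (rule arg_cong)
    then have "\<psi> \<bullet> u = \<beta>" unfolding giso_cancel_right[OF l b] .
    with \<psi> show "\<exists>\<psi>. cell \<psi> (M \<otimes> N) N' h k \<and> \<psi> \<bullet> u = \<beta>" by blast
  next
    fix N' h k \<psi> \<psi>'
    assume \<psi>: "cell \<psi> (M \<otimes> N) N' h k" and \<psi>': "cell \<psi>' (M \<otimes> N) N' h k"
      and eq: "\<psi> \<bullet> u = \<psi>' \<bullet> u"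
    note h = cell_Src[OF \<psi>, unfolded V] and k = cell_Tgt[OF \<psi>, unfolded V]
    have kB: "k \<Zsemi> \<one> B = k" by (rule comp_vid[OF k])
    note uk = cell_Unit[OF k] and uh = cell_Unit[OF h] and uP = cell_Unit[OF i(3)]
    have m: "cell (\<one>\<^sub>1 M) M M (\<one> P) (\<one> B)" using cell_cid[OF o(1)] M by simp
    \<comment> \<open>The two units are applied one at a time, first \<open>\<eta>\<close> in
      \<open>K\<close> and then \<open>\<epsilon>\<close> in \<open>J\<close>; the proof cancels
      \<open>K\<close> first and \<open>J\<close> afterwards.\<close>
    define J where "J = \<one>\<^sub>1 M \<odot> \<epsilon>"
    define K where "K = \<eta> \<odot> U\<^sub>1 (\<one> P)"
    have J: "cell J (M \<otimes> U P) (M \<otimes> N) p (\<one> B)" unfolding J_def by (rule cell_hcomp[OF m d(1)])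
    have K: "cell K (U P \<otimes> U P) (M \<otimes> U P) (\<one> P) q" unfolding K_def by (rule cell_hcomp[OF e(1) uP])
    have JK: "\<eta> \<odot> \<epsilon> = J \<bullet> K"
      unfolding J_def K_def interchange[OF e(1) uP m d(1)] cell_comp_cid(2)[OF e(1)]
      unfolding Unit_vid[OF ABP(3)] cell_comp_cid(1)[OF d(1)] ..
    have \<omega>: "cell (\<psi> \<bullet> J) (M \<otimes> U P) N' (h \<Zsemi> p) k" "cell (\<psi>' \<bullet> J) (M \<otimes> U P) N' (h \<Zsemi> p) k"
      using cell_comp[OF J \<psi>] cell_comp[OF J \<psi>'] kB by auto
    have "\<psi> \<bullet> (\<eta> \<odot> \<epsilon>) = \<psi>' \<bullet> (\<eta> \<odot> \<epsilon>)"
      using eq unfolding u_def cell_assoc[OF lc ed \<psi>, symmetric] cell_assoc[OF lc ed \<psi>', symmetric]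
      by (rule giso_epi[OF giso_sym[OF l] cell_comp[OF ed \<psi> refl refl] cell_comp[OF ed \<psi>' refl refl]])
    then have \<omega>K: "(\<psi> \<bullet> J) \<bullet> K = (\<psi>' \<bullet> J) \<bullet> K"
      unfolding JK cell_assoc[OF K J \<psi>] cell_assoc[OF K J \<psi>'] .
    have ends: "S (U B) = T M" "S M = T (U P)" "S (U P) = T (U P)" "S M = T N" "S N = T (U A)"
      "S (U P) = T N"
      using M N st Src_Unit_ob[OF ABP(2)] Tgt_Unit_ob[OF ABP(1)] by auto
    have MP: "S (M \<otimes> U P) = P" "T (U P \<otimes> N) = P"
      using Src_Hcomp_ob[OF o(1,5)] Tgt_Hcomp_ob[OF o(5,2)] ends st by auto
    obtain a where a: "giso (Assoc D M (U P) (U P)) ((M \<otimes> U P) \<otimes> U P) (M \<otimes> U P \<otimes> U P) a"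
      using giso_Assoc[OF o(1,5,5)] ends by blast
    obtain a' where a': "giso (Assoc D (U B) M (U P)) ((U B \<otimes> M) \<otimes> U P) (U B \<otimes> M \<otimes> U P) a'"
      using giso_Assoc[OF o(4,1,5)] ends by blast
    \<comment> \<open>To cancel \<open>K\<close>, it is composed horizontally with
      \<open>\<phi>\<close>: up to associators, \<open>\<phi> \<odot> K\<close> is
      \<open>\<phi> \<odot> \<eta>\<close> beside an identity, hence invertible.\<close>
    have X: "giso ((\<phi> \<odot> \<eta>) \<odot> U\<^sub>1 (\<one> P)) ((M \<otimes> U P) \<otimes> U P) ((U B \<otimes> M) \<otimes> U P) (j \<odot> \<one>\<^sub>1 (U P))"
      using giso_hcomp[OF pe giso_cid[OF o(5)]] MP st Unit_vid[OF ABP(3)] by simp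
    have "giso ((\<phi> \<odot> K) \<bullet> Assoc D M (U P) (U P)) ((M \<otimes> U P) \<otimes> U P) (U B \<otimes> M \<otimes> U P)
        ((j \<odot> \<one>\<^sub>1 (U P)) \<bullet> a')"
      using giso_comp[OF X a'] Assoc_nat[OF pc e(1) uP] by (simp add: K_def)
    note isoK = giso_left_factor[OF a this cell_hcomp[OF pc K]]
    have "(U\<^sub>1 k \<odot> (\<psi> \<bullet> J)) \<bullet> (\<phi> \<odot> K) = (U\<^sub>1 k \<odot> (\<psi>' \<bullet> J)) \<bullet> (\<phi> \<odot> K)"
      unfolding interchange[OF pc K uk \<omega>(1)] interchange[OF pc K uk \<omega>(2)] \<omega>K ..
    then have "U\<^sub>1 k \<odot> (\<psi> \<bullet> J) = U\<^sub>1 k \<odot> (\<psi>' \<bullet> J)"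
      by (rule giso_epi[OF isoK cell_hcomp[OF uk \<omega>(1)] cell_hcomp[OF uk \<omega>(2)]])
    then have \<psi>J: "\<psi> \<bullet> J = \<psi>' \<bullet> J" by (rule Lunit_faithful[OF \<omega>])
    obtain b where b: "giso (Assoc D M (U P) N) ((M \<otimes> U P) \<otimes> N) (M \<otimes> U P \<otimes> N) b"
      using giso_Assoc[OF o(1,5,2)] ends by blast
    obtain b' where b': "giso (Assoc D M N (U A)) ((M \<otimes> N) \<otimes> U A) (M \<otimes> N \<otimes> U A) b'"
      using giso_Assoc[OF o(1,2,3)] ends by blast
    \<comment> \<open>To cancel \<open>J\<close>, it is composed horizontally with
      \<open>\<gamma>\<close> on the other side: up to associators,
      \<open>J \<odot> \<gamma>\<close> is an identity beside the invertible
      \<open>\<epsilon> \<odot> \<gamma>\<close>.\<close>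
    have Y: "giso (\<one>\<^sub>1 M \<odot> (\<epsilon> \<odot> \<gamma>)) (M \<otimes> U P \<otimes> N) (M \<otimes> N \<otimes> U A) (\<one>\<^sub>1 M \<odot> j')"
      using giso_hcomp[OF giso_cid[OF o(1)] dg] MP M by simp
    have "giso (Assoc D M N (U A) \<bullet> (J \<odot> \<gamma>)) ((M \<otimes> U P) \<otimes> N) (M \<otimes> N \<otimes> U A)
        (b \<bullet> (\<one>\<^sub>1 M \<odot> j'))"
      using giso_comp[OF b Y] Assoc_nat[OF m d(1) gc] by (simp add: J_def)
    note isoJ = giso_right_factor[OF b' this cell_hcomp[OF J gc]]
    have "(\<psi> \<odot> U\<^sub>1 h) \<bullet> (J \<odot> \<gamma>) = (\<psi>' \<odot> U\<^sub>1 h) \<bullet> (J \<odot> \<gamma>)"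
      unfolding interchange[OF J gc \<psi> uh] interchange[OF J gc \<psi>' uh] \<psi>J ..
    then have "\<psi> \<odot> U\<^sub>1 h = \<psi>' \<odot> U\<^sub>1 h"
      by (rule giso_epi[OF isoJ cell_hcomp[OF \<psi> uh] cell_hcomp[OF \<psi>' uh]])
    then show "\<psi> = \<psi>'" by (rule Runit_faithful[OF \<psi> \<psi>'])
  qed
  then show ?thesis by blast
qed

section \<open>Tabulators and pullbacks\<close>

text \<open>Cones over the cospan with apex \<open>H\<close> correspond to cells \<open>U H\<close>
  to \<open>F\<close>: the sides of a cell form a cone, and a cone lifts uniquely through
  \<open>c\<close>. The universal property of the tabulator is thus that of the pullback.\<close>

lemma pullback_of_tabulator:
  assumes up: "unit_pure D" and f: "f \<in> hom (D0 D) A C" and g: "g \<in> hom (D0 D) B C"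
    and c: "is_cartesian D c F (U C) f g" and t: "is_tabulator D F P \<iota>"
  shows "is_pullback (D0 D) f g (ar (Src D) \<iota>) (ar (Tgt D) \<iota>)"
proof -
  define p q where "p = ar (Src D) \<iota>" and "q = ar (Tgt D) \<iota>"
  have C: "C \<in> Obj (D0 D)" using f V.Cod_Obj by (auto simp: hom_def)
  have P: "P \<in> Obj (D0 D)" using t by (simp add: is_tabulator_def)
  have \<iota>: "cell \<iota> (U P) F p q" using t by (simp add: is_tabulator_def is_cell_def p_def q_def)
  have cc: "cell c F (U C) f g" using c by (simp add: is_cartesian_def)
  have F: "S F = A" "T F = B"
    using cell_Src[OF cc] cell_Tgt[OF cc] f g by (auto simp: hom_def)
  have p: "p \<in> hom (D0 D) P A" and q: "q \<in> hom (D0 D) P B"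
    using cell_Src[OF \<iota>] cell_Tgt[OF \<iota>] F Src_Unit_ob[OF P] Tgt_Unit_ob[OF P] by auto
  \<comment> \<open>The second fact of \<open>c\<iota>\<close> is the commutativity
    \<open>f \<Zsemi> p = g \<Zsemi> q\<close> of the square.\<close>
  note c\<iota> = cell_between_units[OF up P cell_comp[OF \<iota> cc refl refl] C]
  have univ: "\<exists>!b. b \<in> hom (D0 D) H P \<and> p \<Zsemi> b = h \<and> q \<Zsemi> b = k"
    if h: "h \<in> hom (D0 D) H A" and k: "k \<in> hom (D0 D) H B" and eq: "f \<Zsemi> h = g \<Zsemi> k" for H h k
  proof -
    have H: "H \<in> Obj (D0 D)" using h V.Dom_Obj by (auto simp: hom_def)
    have "cell (U\<^sub>1 (f \<Zsemi> h)) (U H) (U C) (f \<Zsemi> h) (g \<Zsemi> k)"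
      using cell_Unit[OF V.Comp_hom[OF h f]] eq by simp
    then obtain \<beta> where \<beta>: "cell \<beta> (U H) F h k" "c \<bullet> \<beta> = U\<^sub>1 (f \<Zsemi> h)"
      by (rule cartesian_factor[OF c]) (use h k F in auto)
    \<comment> \<open>Once the sides agree, both cells become
      \<open>U\<^sub>1 (f \<Zsemi> h)\<close> after \<open>c\<close>, so they are equal because
      \<open>c\<close> is Cartesian.\<close>
    have key: "p \<Zsemi> b = h \<and> q \<Zsemi> b = k \<longleftrightarrow> \<iota> \<bullet> U\<^sub>1 b = \<beta>" if b: "b \<in> hom (D0 D) H P" for b
    proof -
      have ib: "cell (\<iota> \<bullet> U\<^sub>1 b) (U H) F (p \<Zsemi> b) (q \<Zsemi> b)"
        by (rule cell_comp[OF cell_Unit[OF b] \<iota> refl refl])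
      have "c \<bullet> (\<iota> \<bullet> U\<^sub>1 b) = U\<^sub>1 (f \<Zsemi> p \<Zsemi> b)"
        unfolding cell_assoc[OF cell_Unit[OF b] \<iota> cc, symmetric] c\<iota>(1)
          Unit_comp[OF b V.Comp_hom[OF p f], symmetric] V.Comp_assoc[OF b p f] ..
      then show ?thesis
        using cartesian_unique[OF c _ \<beta>(1), of "\<iota> \<bullet> U\<^sub>1 b"] ib \<beta> by (auto simp: is_cell_def)
    qed
    have "\<exists>!b. b \<in> hom (D0 D) H P \<and> \<iota> \<bullet> U\<^sub>1 b = \<beta>"
      using t H \<beta>(1) by (auto simp: is_tabulator_def is_cell_def)
    then show ?thesis using key by metis
  qed
  show ?thesis
    unfolding is_pullback_def p_def[symmetric] q_def[symmetric]
    using p q f g c\<iota>(2) univ by blast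
qed

text \<open>The same correspondence of cones and cells, read backwards. It lets strength of
  tabulators apply to an arbitrary pullback square, not just to one that was built from a
  tabulator.\<close>

lemma tabulator_of_pullback:
  assumes up: "unit_pure D" and pb: "is_pullback (D0 D) f g p q"
    and p: "p \<in> hom (D0 D) P A" and q: "q \<in> hom (D0 D) P B"
    and f: "f \<in> hom (D0 D) A C" and g: "g \<in> hom (D0 D) B C"
    and c: "is_cartesian D c W (U C) f g"
    and \<iota>: "cell \<iota> (U P) W p q" and eq: "c \<bullet> \<iota> = U\<^sub>1 (f \<Zsemi> p)"
  shows "is_tabulator D W P \<iota>"
proof -
  have C: "C \<in> Obj (D0 D)" and P: "P \<in> Obj (D0 D)"
    using f p V.Dom_Obj V.Cod_Obj by (auto simp: hom_def)
  have cc: "cell c W (U C) f g" using c by (simp add: is_cartesian_def)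
  have W: "S W = A" "T W = B"
    using cell_Src[OF cc] cell_Tgt[OF cc] f g by (auto simp: hom_def)
  have "\<exists>!b. b \<in> hom (D0 D) H P \<and> \<iota> \<bullet> U\<^sub>1 b = \<beta>"
    if H: "H \<in> Obj (D0 D)" and \<beta>: "\<beta> \<in> hom (D1 D) (U H) W" for H \<beta>
  proof -
    define h k where "h = ar (Src D) \<beta>" and "k = ar (Tgt D) \<beta>"
    have b: "cell \<beta> (U H) W h k" using \<beta> by (simp add: is_cell_def h_def k_def)
    have h: "h \<in> hom (D0 D) H A" and k: "k \<in> hom (D0 D) H B"
      using cell_Src[OF b] cell_Tgt[OF b] W Src_Unit_ob[OF H] Tgt_Unit_ob[OF H] by auto
    \<comment> \<open>By unit-purity the sides of \<open>\<beta>\<close> satisfy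
      \<open>f \<Zsemi> h = g \<Zsemi> k\<close>, so they form a cone.\<close>
    note c\<beta> = cell_between_units[OF up H cell_comp[OF b cc refl refl] C]
    have key: "p \<Zsemi> b = h \<and> q \<Zsemi> b = k \<longleftrightarrow> \<iota> \<bullet> U\<^sub>1 b = \<beta>" if bh: "b \<in> hom (D0 D) H P" for b
    proof -
      have ib: "cell (\<iota> \<bullet> U\<^sub>1 b) (U H) W (p \<Zsemi> b) (q \<Zsemi> b)"
        by (rule cell_comp[OF cell_Unit[OF bh] \<iota> refl refl])
      have "c \<bullet> (\<iota> \<bullet> U\<^sub>1 b) = U\<^sub>1 (f \<Zsemi> p \<Zsemi> b)"
        unfolding cell_assoc[OF cell_Unit[OF bh] \<iota> cc, symmetric] eq
          Unit_comp[OF bh V.Comp_hom[OF p f], symmetric] V.Comp_assoc[OF bh p f] ..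
      then show ?thesis
        using cartesian_unique[OF c _ b, of "\<iota> \<bullet> U\<^sub>1 b"] ib b c\<beta>(1) by (auto simp: is_cell_def)
    qed
    obtain P' A' B' where pb': "p \<in> hom (D0 D) P' A'" "q \<in> hom (D0 D) P' B'"
      "\<forall>H h k. h \<in> hom (D0 D) H A' \<and> k \<in> hom (D0 D) H B' \<and> f \<Zsemi> h = g \<Zsemi> k \<longrightarrow>
        (\<exists>!b. b \<in> hom (D0 D) H P' \<and> p \<Zsemi> b = h \<and> q \<Zsemi> b = k)"
      using pb unfolding is_pullback_def by blast
    \<comment> \<open>\<open>is_pullback\<close> binds its own objects; the typings of
      \<open>p\<close> and \<open>q\<close> identify them with the given ones.\<close>
    then have "P' = P" "A' = A" "B' = B" using p q by (auto simp: hom_def)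
    with pb'(3) h k c\<beta>(2) have "\<exists>!b. b \<in> hom (D0 D) H P \<and> p \<Zsemi> b = h \<and> q \<Zsemi> b = k" by blast
    then show ?thesis using key by metis
  qed
  then show ?thesis
    using P cell_hom[OF \<iota>] by (simp add: is_tabulator_def)
qed

section \<open>Existence of pullbacks and the Beck-Chevalley condition\<close>

lemma has_pullbacks_D0:
  assumes "unit_pure D" "fibrant D" "has_tabulators D"
  shows "has_pullbacks (D0 D)"
  unfolding has_pullbacks_def
proof (intro allI impI)
  fix A B C f g
  assume fg: "f \<in> hom (D0 D) A C \<and> g \<in> hom (D0 D) B C"
  then have C: "C \<in> Obj (D0 D)" using V.Cod_Obj by (auto simp: hom_def)
  obtain c F where c: "is_cartesian D c F (U C) f g"
    using assms(2) fg Unit_Obj[OF C] Src_Unit_ob[OF C] Tgt_Unit_ob[OF C]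
    by (fastforce simp: fibrant_def hom_def)
  then have "F \<in> Obj (D1 D)" using cell_Obj(1) by (auto simp: is_cartesian_def)
  then obtain P \<iota> where "is_tabulator D F P \<iota>"
    using assms(3) by (auto simp: has_tabulators_def)
  then show "\<exists>q1 q2. is_pullback (D0 D) f g q1 q2"
    using pullback_of_tabulator[OF assms(1) _ _ c] fg by blast
qed

text \<open>Factoring \<open>U\<^sub>1 (f \<Zsemi> p)\<close> through \<open>c\<close> gives a
  tabulator \<open>\<iota>\<close> of \<open>W\<close>. The comparison cell is the globular cell
  that \<open>u\<close> induces from \<open>\<iota>\<close>, which strength makes
  invertible.\<close>

lemma is_iso_comparison_cell:
  assumes up: "unit_pure D" and str: "strong_tabulators D"
    and pb: "is_pullback (D0 D) f g p q"
    and p: "p \<in> hom (D0 D) P A" and q: "q \<in> hom (D0 D) P B"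
    and f: "f \<in> hom (D0 D) A C" and g: "g \<in> hom (D0 D) B C" and eq: "f \<Zsemi> p = g \<Zsemi> q"
    and M: "is_companion D q M" and N: "is_conjoint D p N"
    and u: "is_op_cartesian D u (U P) (M \<otimes> N) p q"
    and c: "is_cartesian D c W (U C) f g"
  shows "is_iso (D1 D) (comparison_cell D (M \<otimes> N) W u c (U\<^sub>1 (f \<Zsemi> p)))"
proof -
  have cc: "cell c W (U C) f g" using c by (simp add: is_cartesian_def)
  have uc: "cell u (U P) (M \<otimes> N) p q" using u by (simp add: is_op_cartesian_def)
  have P: "P \<in> Obj (D0 D)" using p V.Dom_Obj by (auto simp: hom_def)
  have W: "S W = A" "T W = B"
    using cell_Src[OF cc] cell_Tgt[OF cc] f g by (auto simp: hom_def)
  have V: "S (M \<otimes> N) = A" "T (M \<otimes> N) = B"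
    using cell_Src[OF uc] cell_Tgt[OF uc] p q by (auto simp: hom_def)
  have "cell (U\<^sub>1 (f \<Zsemi> p)) (U P) (U C) (f \<Zsemi> p) (g \<Zsemi> q)"
    using cell_Unit[OF V.Comp_hom[OF p f]] eq by simp
  then obtain \<iota> where \<iota>: "cell \<iota> (U P) W p q" "c \<bullet> \<iota> = U\<^sub>1 (f \<Zsemi> p)"
    by (rule cartesian_factor[OF c]) (use p q W in auto)
  \<comment> \<open>Cancelling \<open>c\<close> identifies the predicates under the two description
    operators, so the described cells coincide before anything is known about their
    existence.\<close>
  have "c \<bullet> y \<bullet> u = U\<^sub>1 (f \<Zsemi> p) \<longleftrightarrow> y \<bullet> u = \<iota>" if y: "is_globular D y (M \<otimes> N) W" for y
  proof -
    have "cell (y \<bullet> u) (U P) W p q"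
      by (rule cell_comp[OF uc y[unfolded is_globular_def V]])
        (simp_all add: comp_vid[OF p] comp_vid[OF q])
    from cartesian_unique[OF c this \<iota>(1)] show ?thesis using \<iota>(2) by auto
  qed
  then have "comparison_cell D (M \<otimes> N) W u c (U\<^sub>1 (f \<Zsemi> p)) =
      (THE y. is_globular D y (M \<otimes> N) W \<and> y \<bullet> u = \<iota>)"
    unfolding comparison_cell_def by (intro arg_cong[where f = The] ext) blast
  moreover have "is_tabulator D W P \<iota>"
    by (rule tabulator_of_pullback[OF up pb p q f g c \<iota>])
  ultimately show ?thesis
    using str \<iota>(1) M N u cell_Obj(1)[OF cc] unfolding strong_tabulators_def by auto
qed

text \<open>The condition supplies the companions and conjoints, and their units and counits already
  yield the universal cells of its existence clauses.\<close>

lemma beck_chevalley_if_strong_tabulators: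
  assumes up: "unit_pure D" and str: "strong_tabulators D"
  shows "beck_chevalley D"
  unfolding beck_chevalley_def Let_def
proof (intro allI impI, elim conjE)
  fix f g p q Mq Nq Mg Nf
  assume pb: "is_pullback (D0 D) f g p q"
    and M: "is_companion D q Mq" and N: "is_conjoint D p Nq"
    and Mg: "is_conjoint D g Mg" and Nf: "is_companion D f Nf"
  obtain P A B C where p: "p \<in> hom (D0 D) P A" and q: "q \<in> hom (D0 D) P B"
    and f: "f \<in> hom (D0 D) A C" and g: "g \<in> hom (D0 D) B C" and eq: "f \<Zsemi> p = g \<Zsemi> q"
    using pb unfolding is_pullback_def by blast
  have ends: "Dom (D0 D) p = P" "Cod (D0 D) f = C" using p f by (auto simp: hom_def)
  show "(\<exists>u. is_op_cartesian D u (U (Dom (D0 D) p)) (Mq \<otimes> Nq) p q) \<and>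
      (\<exists>c. is_cartesian D c (Mg \<otimes> Nf) (U (Cod (D0 D) f)) f g) \<and>
      (\<forall>u c. is_op_cartesian D u (U (Dom (D0 D) p)) (Mq \<otimes> Nq) p q \<and>
        is_cartesian D c (Mg \<otimes> Nf) (U (Cod (D0 D) f)) f g \<longrightarrow>
        is_iso (D1 D) (comparison_cell D (Mq \<otimes> Nq) (Mg \<otimes> Nf) u c (U\<^sub>1 (f \<Zsemi> p))))"
    unfolding ends
    using ex_op_cartesian_companion_conjoint[OF up p q M N]
      ex_cartesian_conjoint_companion[OF up f g Mg Nf]
      is_iso_comparison_cell[OF up str pb p q f g eq M N]
    by simp
qed

end

theorem proposition5p2p3:
  fixes D :: "('o, 'v, 'h, 'c) double_cat"
  assumes "double_category D"
    and "unit_pure D"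
    and "fibrant D"
    and "has_tabulators D"
  shows "has_pullbacks (D0 D) \<and> (strong_tabulators D \<longrightarrow> beck_chevalley D)"
  using double_category.has_pullbacks_D0[OF assms]
    double_category.beck_chevalley_if_strong_tabulators[OF assms(1,2)]
  by blast

end
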